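(* Let $C^+(u,v)=\min\{u,v\}$ and $C^-(u,v)=\max\{u+v-1,0\}$ for $u,v\in[0,1]$. (1) For every super-linear expectation $\mathcal E$ and every cost function $c:\mathbb R^2\to\mathbb R$ that is monotone and submodular, the copula $C^+$ is universally optimal for $(c,\mathcal E)$. (2) For every sub-linear expectation $\mathcal E$ and every cost function $c:\mathbb R^2\to\mathbb R$ that is monotone and supermodular, the copula $C^-$ is universally optimal for $(c,\mathcal E)$.
   Context: Fix an atomless probability space $(\Omega,\mathcal A,\mathbb P)$ and let $\mathcal X$ be the set of bounded random variables on it; (in)equalities between random variables are almost sure. $X\overset{\mathrm d}{=}X'$ means that $X,X'$ have the same law under $\mathbb P$. A non-linear expectation is a map $\mathcal E:\mathcal X\to\mathbb R$ satisfying: (i) $\mathcal E[X]\le\mathcal E[Y]$ if $X\le Y$; (ii) $\mathcal E[a]=a$ for constants $a\in\mathbb R$; (iii) $\mathcal E[X]=\mathcal E[Y]$ if $X\overset{\mathrm d}{=}Y$. It is sub-linear if moreover $\mathcal E[X+Y]\le\mathcal E[X]+\mathcal E[Y]$ for all $X,Y\in\mathcal X$ and $\mathcal E[\lambda X]=\lambda\mathcal E[X]$ for all $\lambda\ge0$, $X\in\mathcal X$. It is super-linear if moreover $\mathcal E[X+Y]\ge\mathcal E[X]+\mathcal E[Y]$ for all $X,Y\in\mathcal X$ and $\mathcal E[\lambda X]=\lambda\mathcal E[X]$ for all $\lambda\ge0$, $X\in\mathcal X$. A cost function is a Borel measurable $c:\mathbb R^2\to\mathbb R$. It is monotone if it is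 increasing (non-strictly) in each component, or decreasing (non-strictly) in each component. It is submodular if $c(\mathbf u\wedge\mathbf v)+c(\mathbf u\vee\mathbf v)\le c(\mathbf u)+c(\mathbf v)$ for all $\mathbf u,\mathbf v\in\mathbb R^2$ (component-wise minimum and maximum), and supermodular if $-c$ is submodular. A copula is a distribution function on $[0,1]^2$ with uniform $[0,1]$ marginals. $C$ is a copula of $(X,Y)$ if $\mathbb P(X\le x,Y\le y)=C(\mathbb P(X\le x),\mathbb P(Y\le y))$ for all $x,y\in\mathbb R$. A copula $C$ is universally optimal for $(c,\mathcal E)$ if for all $X,Y\in\mathcal X$ such that $C$ is a copula of $(X,Y)$, $\mathcal E[c(X,Y)]\le\mathcal E[c(X',Y')]$ for all $X',Y'\in\mathcal X$ with $X'\overset{\mathrm d}{=}X$ and $Y'\overset{\mathrm d}{=}Y$. *)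

theory Defs
  imports "HOL-Probability.Probability"
begin

definition atomless :: "'a measure \<Rightarrow> bool" where
  "atomless M \<longleftrightarrow> (\<forall>A\<in>sets M. measure M A > 0 \<longrightarrow>
     (\<exists>B\<in>sets M. B \<subseteq> A \<and> 0 < measure M B \<and> measure M B < measure M A))"

text \<open>Inequalities between random variables are almost sure, and so is the bound here.
  Random variables are functions rather than equivalence classes; monotonicity with respect to the
  almost sure order forces a non-linear expectation to be constant on almost sure equivalence
  classes. Its values outside \<^term>\<open>bounded_rvs M\<close> are irrelevant: for a monotone cost \<open>c\<close> and
  bounded \<open>X\<close>, \<open>Y\<close>, also \<open>c (X, Y)\<close> is bounded.\<close>

definition bounded_rvs :: "'a measure \<Rightarrow> ('a \<Rightarrow> real) set" where
  "bounded_rvs M = {X \<in> borel_measurable M. \<exists>K. AE \<omega> in M. \<bar>X \<omega>\<bar> \<le> K}"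

definition eq_law :: "'a measure \<Rightarrow> ('a \<Rightarrow> real) \<Rightarrow> ('a \<Rightarrow> real) \<Rightarrow> bool" where
  "eq_law M X Y \<longleftrightarrow> distr M borel X = distr M borel Y"

definition nonlinear_expectation :: "'a measure \<Rightarrow> (('a \<Rightarrow> real) \<Rightarrow> real) \<Rightarrow> bool" where
  "nonlinear_expectation M E \<longleftrightarrow>
     (\<forall>X\<in>bounded_rvs M. \<forall>Y\<in>bounded_rvs M. (AE \<omega> in M. X \<omega> \<le> Y \<omega>) \<longrightarrow> E X \<le> E Y) \<and>
     (\<forall>a. E (\<lambda>_. a) = a) \<and>
     (\<forall>X\<in>bounded_rvs M. \<forall>Y\<in>bounded_rvs M. eq_law M X Y \<longrightarrow> E X = E Y)"

definition sublinear_expectation :: "'a measure \<Rightarrow> (('a \<Rightarrow> real) \<Rightarrow> real) \<Rightarrow> bool" where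
  "sublinear_expectation M E \<longleftrightarrow> nonlinear_expectation M E \<and>
     (\<forall>X\<in>bounded_rvs M. \<forall>Y\<in>bounded_rvs M. E (\<lambda>\<omega>. X \<omega> + Y \<omega>) \<le> E X + E Y) \<and>
     (\<forall>X\<in>bounded_rvs M. \<forall>r\<ge>0. E (\<lambda>\<omega>. r * X \<omega>) = r * E X)"

definition superlinear_expectation :: "'a measure \<Rightarrow> (('a \<Rightarrow> real) \<Rightarrow> real) \<Rightarrow> bool" where
  "superlinear_expectation M E \<longleftrightarrow> nonlinear_expectation M E \<and>
     (\<forall>X\<in>bounded_rvs M. \<forall>Y\<in>bounded_rvs M. E (\<lambda>\<omega>. X \<omega> + Y \<omega>) \<ge> E X + E Y) \<and>
     (\<forall>X\<in>bounded_rvs M. \<forall>r\<ge>0. E (\<lambda>\<omega>. r * X \<omega>) = r * E X)"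

definition cost_function :: "(real \<times> real \<Rightarrow> real) \<Rightarrow> bool" where
  "cost_function c \<longleftrightarrow> c \<in> borel_measurable borel"

definition monotone_cost :: "(real \<times> real \<Rightarrow> real) \<Rightarrow> bool" where
  "monotone_cost c \<longleftrightarrow>
     ((\<forall>y. mono (\<lambda>x. c (x, y))) \<and> (\<forall>x. mono (\<lambda>y. c (x, y)))) \<or>
     ((\<forall>y. antimono (\<lambda>x. c (x, y))) \<and> (\<forall>x. antimono (\<lambda>y. c (x, y))))"

text \<open>On \<^typ>\<open>real \<times> real\<close>, \<^const>\<open>inf\<close> and \<^const>\<open>sup\<close> are the component-wise minimum and maximum.\<close>

definition submodular :: "(real \<times> real \<Rightarrow> real) \<Rightarrow> bool" where
  "submodular c \<longleftrightarrow> (\<forall>u v. c (inf u v) + c (sup u v) \<le> c u + c v)"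

definition supermodular :: "(real \<times> real \<Rightarrow> real) \<Rightarrow> bool" where
  "supermodular c \<longleftrightarrow> submodular (\<lambda>u. - c u)"

text \<open>A copula is a function on the unit square: only its values there are constrained or used.
  The uniform marginals force \<open>\<mu>\<close> to be a probability measure concentrated on the unit square.\<close>

definition copula :: "(real \<Rightarrow> real \<Rightarrow> real) \<Rightarrow> bool" where
  "copula C \<longleftrightarrow> (\<exists>\<mu> :: (real \<times> real) measure. prob_space \<mu> \<and> sets \<mu> = sets borel \<and>
     distr \<mu> borel fst = uniform_measure lborel {0..1} \<and>
     distr \<mu> borel snd = uniform_measure lborel {0..1} \<and>
     (\<forall>u\<in>{0..1}. \<forall>v\<in>{0..1}. C u v = measure \<mu> ({..u} \<times> {..v})))"

definition copula_of ::
  "'a measure \<Rightarrow> (real \<Rightarrow> real \<Rightarrow> real) \<Rightarrow> ('a \<Rightarrow> real) \<Rightarrow> ('a \<Rightarrow> real) \<Rightarrow> bool" where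
  "copula_of M C X Y \<longleftrightarrow> (\<forall>x y.
     measure M {\<omega>\<in>space M. X \<omega> \<le> x \<and> Y \<omega> \<le> y} =
     C (measure M {\<omega>\<in>space M. X \<omega> \<le> x}) (measure M {\<omega>\<in>space M. Y \<omega> \<le> y}))"

definition universally_optimal ::
  "'a measure \<Rightarrow> (real \<times> real \<Rightarrow> real) \<Rightarrow> (('a \<Rightarrow> real) \<Rightarrow> real) \<Rightarrow> (real \<Rightarrow> real \<Rightarrow> real) \<Rightarrow> bool" where
  "universally_optimal M c E C \<longleftrightarrow> copula C \<and>
     (\<forall>X\<in>bounded_rvs M. \<forall>Y\<in>bounded_rvs M. copula_of M C X Y \<longrightarrow>
       (\<forall>X'\<in>bounded_rvs M. \<forall>Y'\<in>bounded_rvs M. eq_law M X' X \<longrightarrow> eq_law M Y' Y \<longrightarrow>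
         E (\<lambda>\<omega>. c (X \<omega>, Y \<omega>)) \<le> E (\<lambda>\<omega>. c (X' \<omega>, Y' \<omega>))))"

definition C_plus :: "real \<Rightarrow> real \<Rightarrow> real" where
  "C_plus u v = min u v"

definition C_minus :: "real \<Rightarrow> real \<Rightarrow> real" where
  "C_minus u v = max (u + v - 1) 0"

end

(* A law-invariant super-linear expectation E on an atomless space is monotone for the increasing
   concave order. Transport E to (0,1) by a uniform random variable and compare increasing quantile
   functions. Averaging a function over its rotations on an interval does not decrease E, by
   super-linearity and law invariance, and for increasing functions these averages converge uniformly
   to the mean; so E increases under averaging over intervals, hence under transfers of mass from a
   cell of a partition to the preceding one.

   If c is monotone and supermodular, then each (t + c)^+ is supermodular, whence by duality its
   integral over all couplings of two fixed laws is largest for the comonotone coupling C+ and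
   smallest for the countermonotone coupling C-. With -c in place of c in part (1), this is the
   increasing concave order between the two costs. Part (2) follows by passing to X |-> -E(-X). *)

theory Submission
  imports Defs
begin

section \<open>Uniform random variables on atomless spaces\<close>

text \<open>The only continuity of \<open>E\<close> at hand is that in the supremum norm, so every
  limit must be uniform or enter through an additive constant. Increasing functions on (0,1) allow
  this: their rotation averages exceed the mean by at most 2 B / n, while for a general bounded
  function uniform convergence can fail. For the same reason the quantile functions are replaced by
  finite step functions, on a partition adapted to their oscillation.

  Moving mass between two neighbouring cells is a partial averaging only while the left value stays
  below the right one. The dominating step function is therefore given a small slope, and only a
  small fraction of every transfer is carried out; concavity of \<open>E\<close> recovers the full
  comparison.

  The increasing concave order enters as a comparison of the integrals of (t - Z)^+ for all t. For
  the coupling problem this is convenient because (t - Z)^+ is again a function of the pair; for the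
  steps it is convenient because it yields a comparison of the integrals of the quantile functions
  over every initial interval, and these are the partial sums that the transfers need.\<close>

context prob_space begin

text \<open>A subset of strictly smaller positive measure and its relative complement cannot both
  exceed half of the measure, so one of them halves it, and this can be repeated.\<close>

lemma atomless_small_subset:
  assumes "atomless M" "A \<in> sets M" "measure M A > 0" "e > 0"
  shows "\<exists>B\<in>sets M. B \<subseteq> A \<and> 0 < measure M B \<and> measure M B \<le> e"
proof -
  have *: "\<exists>B\<in>sets M. B \<subseteq> A \<and> 0 < measure M B \<and> measure M B \<le> 1 / 2 ^ n" for n
  proof (induction n)
    case 0
    then show ?case using assms by (intro bexI[of _ A]) auto
  next
    case (Suc n)
    then obtain B where B: "B \<in> sets M" "B \<subseteq> A" "0 < measure M B" "measure M B \<le> 1 / 2 ^ n"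
      by auto
    then obtain C where C: "C \<in> sets M" "C \<subseteq> B" "0 < measure M C" "measure M C < measure M B"
      using assms(1) unfolding atomless_def by meson
    have d: "measure M (B - C) = measure M B - measure M C"
      using B C by (intro finite_measure_Diff) auto
    show ?case
    proof (cases "measure M C \<le> measure M B / 2")
      case True
      then show ?thesis using B C by (intro bexI[of _ C]) auto
    next
      case False
      then show ?thesis using B C d by (intro bexI[of _ "B - C"]) auto
    qed
  qed
  obtain n where "(1/2::real)^n < e" using real_arch_pow_inv[of e "1/2"] assms by auto
  moreover obtain B where "B \<in> sets M" "B \<subseteq> A" "0 < measure M B" "measure M B \<le> 1 / 2 ^ n"
    using *[of n] by blast
  ultimately show ?thesis by (intro bexI[of _ B]) (auto simp: power_one_over inverse_eq_divide)
qed

text \<open>One step of an exhaustion. \<open>S\<close> collects the masses that can still be added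
  to \<open>B\<close> below the level \<open>t\<close>. Its supremum need not be attained, so the
  added set only takes more than half of it; if the supremum is 0, \<open>B\<close> itself will
  do.\<close>

lemma atomless_subset_greedy:
  assumes "B \<in> sets M" "B \<subseteq> A" "A \<in> sets M" "measure M B \<le> t"
  shows "\<exists>B'\<in>sets M. B \<subseteq> B' \<and> B' \<subseteq> A \<and> measure M B' \<le> t \<and>
    (\<forall>C\<in>sets M. C \<subseteq> A - B \<longrightarrow> measure M B + measure M C \<le> t \<longrightarrow>
       measure M C \<le> 2 * (measure M B' - measure M B))"
proof -
  define S where "S = {measure M C | C. C \<in> sets M \<and> C \<subseteq> A - B \<and> measure M B + measure M C \<le> t}"
  have ne: "0 \<in> S" unfolding S_def using assms by (auto intro!: exI[of _ "{}"])
  have bdd: "bdd_above S" unfolding S_def by (auto intro!: bdd_aboveI[of _ 1])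
  have le: "measure M C \<le> Sup S" if "C \<in> sets M" "C \<subseteq> A - B" "measure M B + measure M C \<le> t" for C
  proof (rule cSup_upper[OF _ bdd])
    show "measure M C \<in> S" unfolding S_def using that by blast
  qed
  show ?thesis
  proof (cases "Sup S > 0")
    case False
    then have "measure M C \<le> 0" if "C \<in> sets M" "C \<subseteq> A - B" "measure M B + measure M C \<le> t" for C
      using le[OF that] False by simp
    then show ?thesis using assms by (intro bexI[of _ B]) auto
  next
    case True
    then have "Sup S / 2 < Sup S" by simp
    then obtain s where s: "s \<in> S" "Sup S / 2 < s"
      using less_cSupE ne by (metis empty_iff)
    then obtain C where C: "s = measure M C" "C \<in> sets M" "C \<subseteq> A - B" "measure M B + measure M C \<le> t"
      unfolding S_def by auto
    have u: "measure M (B \<union> C) = measure M B + measure M C"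
      using assms C by (intro finite_measure_Union) auto
    have "measure M D \<le> 2 * measure M C" if "D \<in> sets M" "D \<subseteq> A - B" "measure M B + measure M D \<le> t" for D
      using le[OF that] s C by simp
    then show ?thesis using assms C u by (intro bexI[of _ "B \<union> C"]) auto
  qed
qed

text \<open>Sierpinski's theorem. In the greedy sequence each step takes at least half of what could
  still be added, so that nothing of positive measure fits in the limit.\<close>

lemma atomless_subset:
  assumes at: "atomless M" and A: "A \<in> sets M" and t: "0 \<le> t" "t \<le> measure M A"
  shows "\<exists>B\<in>sets M. B \<subseteq> A \<and> measure M B = t"
proof -
  have "\<exists>f. \<forall>n::nat. (f n \<in> sets M \<and> f n \<subseteq> A \<and> measure M (f n) \<le> t) \<and>
    (f n \<subseteq> f (Suc n) \<and> (\<forall>C\<in>sets M. C \<subseteq> A - f n \<longrightarrow> measure M (f n) + measure M C \<le> t \<longrightarrow>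
       measure M C \<le> 2 * (measure M (f (Suc n)) - measure M (f n))))"
  proof (intro dependent_nat_choice)
    show "\<exists>x. x \<in> events \<and> x \<subseteq> A \<and> prob x \<le> t" using t by (intro exI[of _ "{}"]) auto
  next
    fix x n assume "x \<in> events \<and> x \<subseteq> A \<and> prob x \<le> t"
    then show "\<exists>y. (y \<in> events \<and> y \<subseteq> A \<and> prob y \<le> t) \<and>
             x \<subseteq> y \<and> (\<forall>C\<in>events. C \<subseteq> A - x \<longrightarrow> prob x + prob C \<le> t \<longrightarrow> prob C \<le> 2 * (prob y - prob x))"
      using atomless_subset_greedy[of x A t] A by blast
  qed
  then obtain f where F: "\<forall>n::nat. (f n \<in> sets M \<and> f n \<subseteq> A \<and> measure M (f n) \<le> t) \<and>
    (f n \<subseteq> f (Suc n) \<and> (\<forall>C\<in>sets M. C \<subseteq> A - f n \<longrightarrow> measure M (f n) + measure M C \<le> t \<longrightarrow>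
       measure M C \<le> 2 * (measure M (f (Suc n)) - measure M (f n))))"
    by (rule exE)
  then have f: "f n \<in> sets M" "f n \<subseteq> A" "measure M (f n) \<le> t" "f n \<subseteq> f (Suc n)" for n
    by simp_all
  have gr: "measure M C \<le> 2 * (measure M (f (Suc n)) - measure M (f n))"
    if "C \<in> sets M" "C \<subseteq> A - f n" "measure M (f n) + measure M C \<le> t" for n C
    using F that by simp
  define B where "B = (\<Union>n. f n)"
  have B: "B \<in> sets M" "B \<subseteq> A" unfolding B_def using f by auto
  have inc: "incseq f" using f(4) by (rule incseq_SucI)
  have lim: "(\<lambda>n. measure M (f n)) \<longlonglongrightarrow> measure M B"
    unfolding B_def using f inc by (intro finite_Lim_measure_incseq) auto
  have le: "measure M B \<le> t" using lim f(3) by (intro LIMSEQ_le_const2[OF lim]) auto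
  have fB: "measure M (f n) \<le> measure M B" for n
    using B by (intro finite_measure_mono) (auto simp: B_def)
  have "measure M B = t"
  proof (rule ccontr)
    assume "measure M B \<noteq> t"
    with le have lt: "measure M B < t" by simp
    have "measure M (A - B) = measure M A - measure M B" using A B by (intro finite_measure_Diff) auto
    then have "measure M (A - B) > 0" using lt t by simp
    then obtain C where C: "C \<in> sets M" "C \<subseteq> A - B" "0 < measure M C" "measure M C \<le> t - measure M B"
      using atomless_small_subset[OF at, of "A - B" "t - measure M B"] A B lt by auto
    \<comment> \<open>\<open>C\<close> avoids the limit and fits below \<open>t\<close> at every
      stage, so every increment must be at least half of its mass, although the increments tend to
      0.\<close>
    have "measure M C \<le> 2 * (measure M (f (Suc n)) - measure M (f n))" for n
    proof (rule gr[OF C(1)])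
      show "C \<subseteq> A - f n" using C(2) unfolding B_def by blast
      show "measure M (f n) + measure M C \<le> t" using fB[of n] C(4) by linarith
    qed
    moreover have "(\<lambda>n. 2 * (measure M (f (Suc n)) - measure M (f n))) \<longlonglongrightarrow> 2 * (measure M B - measure M B)"
      by (intro tendsto_intros lim LIMSEQ_Suc)
    ultimately have "measure M C \<le> 2 * (measure M B - measure M B)"
      by (intro LIMSEQ_le_const[of _ _ "measure M C"]) auto
    then show False using C(3) by simp
  qed
  then show ?thesis using B by auto
qed

lemma atomless_intermediate:
  assumes "atomless M" "A \<in> sets M" "B \<in> sets M" "A \<subseteq> B" "measure M A \<le> t" "t \<le> measure M B"
  shows "\<exists>C\<in>sets M. A \<subseteq> C \<and> C \<subseteq> B \<and> measure M C = t"
proof -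
  have d: "measure M (B - A) = measure M B - measure M A"
    using assms by (intro finite_measure_Diff) auto
  then obtain D where D: "D \<in> sets M" "D \<subseteq> B - A" "measure M D = t - measure M A"
    using atomless_subset[OF assms(1), of "B - A" "t - measure M A"] assms by auto
  have "measure M (A \<union> D) = measure M A + measure M D"
    using assms D by (intro finite_measure_Union) auto
  then show ?thesis using assms D by (intro bexI[of _ "A \<union> D"]) auto
qed

text \<open>Up to a null set, \<open>D n k\<close> will be the event that a uniform variable is at
  most \<open>k / 2 ^ n\<close>. The identity between consecutive levels makes this a chain indexed
  by the dyadic rationals.\<close>

lemma atomless_dyadic_chain:
  assumes at: "atomless M"
  shows "\<exists>D :: nat \<Rightarrow> nat \<Rightarrow> 'a set. D 0 1 = space M \<and>
    (\<forall>n. \<forall>k\<le>2 ^ n. D n k \<in> sets M \<and> measure M (D n k) = k / 2 ^ n \<and> D (Suc n) (2 * k) = D n k \<and>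
       (\<forall>j\<le>k. D n j \<subseteq> D n k))"
proof -
  define P where "P = (\<lambda>n (f :: nat \<Rightarrow> 'a set). (\<forall>k\<le>2 ^ n. f k \<in> sets M \<and> measure M (f k) = k / 2 ^ n) \<and>
      (\<forall>k<2 ^ n. f k \<subseteq> f (Suc k)) \<and> (n = 0 \<longrightarrow> f 1 = space M))"
  have "\<exists>D. \<forall>n. P n (D n) \<and> (\<forall>k\<le>2 ^ n. D (Suc n) (2 * k) = D n k)"
  proof (intro dependent_nat_choice)
    show "\<exists>f. P 0 f"
      by (rule exI[of _ "\<lambda>k. if k = 0 then {} else space M"]) (auto simp: P_def prob_space le_Suc_eq)
  next
    fix f n assume f: "P n f"
    have "\<exists>C. C \<in> sets M \<and> f k \<subseteq> C \<and> C \<subseteq> f (Suc k) \<and> measure M C = (2 * k + 1) / 2 ^ Suc n"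
      if "k < 2 ^ n" for k
    proof -
      have "f k \<in> sets M" "f (Suc k) \<in> sets M" "f k \<subseteq> f (Suc k)"
        "measure M (f k) = k / 2 ^ n" "measure M (f (Suc k)) = Suc k / 2 ^ n"
        using f that by (auto simp: P_def)
      then show ?thesis
        using atomless_intermediate[OF at, of "f k" "f (Suc k)" "(2 * k + 1) / 2 ^ Suc n"]
        by (force simp: field_simps)
    qed
    then obtain C where C: "\<And>k. k < 2 ^ n \<Longrightarrow> C k \<in> sets M \<and> f k \<subseteq> C k \<and> C k \<subseteq> f (Suc k) \<and> measure M (C k) = (2 * k + 1) / 2 ^ Suc n"
      by metis
    \<comment> \<open>Even indices keep the old chain; odd ones insert a set halfway, in measure,
      between two old neighbours.\<close>
    define g where "g = (\<lambda>k. if even k then f (k div 2) else C (k div 2))"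
    have "P (Suc n) g"
      unfolding P_def
    proof (intro conjI allI impI)
      fix k :: nat assume k: "k \<le> 2 ^ Suc n"
      have "g k \<in> sets M \<and> measure M (g k) = k / 2 ^ Suc n"
      proof (cases "even k")
        case True
        then obtain l where l: "k = 2 * l" by blast
        then have "l \<le> 2 ^ n" using k by simp
        then show ?thesis using f l by (simp add: g_def P_def)
      next
        case False
        then obtain l where l: "k = 2 * l + 1" by (rule oddE)
        then have "l < 2 ^ n" using k by simp
        then show ?thesis using C[of l] l by (simp add: g_def)
      qed
      then show "g k \<in> sets M" "measure M (g k) = k / 2 ^ Suc n" by auto
    next
      fix k :: nat assume k: "k < 2 ^ Suc n"
      show "g k \<subseteq> g (Suc k)"
      proof (cases "even k")
        case True
        then obtain l where l: "k = 2 * l" by blast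
        then have "l < 2 ^ n" using k by simp
        then show ?thesis using C[of l] l by (simp add: g_def)
      next
        case False
        then obtain l where l: "k = 2 * l + 1" by (rule oddE)
        then have "l < 2 ^ n" using k by simp
        then show ?thesis using C[of l] l by (simp add: g_def)
      qed
    qed auto
    moreover have "\<forall>k\<le>2 ^ n. g (2 * k) = f k" by (simp add: g_def)
    ultimately show "\<exists>g. P (Suc n) g \<and> (\<forall>k\<le>2 ^ n. g (2 * k) = f k)" by blast
  qed
  then obtain D where "\<forall>n. P n (D n) \<and> (\<forall>k\<le>2 ^ n. D (Suc n) (2 * k) = D n k)" by (rule exE)
  then have D: "P n (D n)" "k \<le> 2 ^ n \<Longrightarrow> D (Suc n) (2 * k) = D n k" for n k by simp_all
  have D': "k \<le> 2 ^ n \<Longrightarrow> D n k \<in> sets M" "k \<le> 2 ^ n \<Longrightarrow> measure M (D n k) = k / 2 ^ n"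
    "k < 2 ^ n \<Longrightarrow> D n k \<subseteq> D n (Suc k)" "D 0 1 = space M" for n k
    using D(1)[of n] D(1)[of 0] unfolding P_def by simp_all
  have D2: "D n j \<subseteq> D n k" if "j \<le> k" "k \<le> 2 ^ n" for n j k
    using that
  proof (induction k rule: dec_induct)
    case (step m)
    then show ?case using D'(3)[of m n] by simp
  qed simp
  show ?thesis
  proof (intro exI[of _ D] conjI allI impI)
    show "D 0 1 = space M" by (rule D'(4))
  qed (simp_all only: D(2) D'(1,2) D2)
qed

end

text \<open>The end points are left out because a quantile function is controlled only strictly
  between 0 and 1.\<close>

definition unit_space :: "real measure" where
  "unit_space = restrict_space lborel {0<..<1}"

lemma space_unit_space [simp]: "space unit_space = {0<..<1}"
  by (simp add: unit_space_def space_restrict_space)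

lemma sets_unit_space: "sets unit_space = sets (restrict_space borel {0<..<1})"
  unfolding unit_space_def by (rule sets_restrict_space_cong) simp

lemma measurable_unit_space [measurable (raw)]:
  "f \<in> borel_measurable borel \<Longrightarrow> f \<in> borel_measurable unit_space"
  unfolding unit_space_def by (auto intro!: measurable_restrict_space1)

lemma prob_space_unit_space: "prob_space unit_space"
  by (auto simp: unit_space_def emeasure_restrict_space space_restrict_space intro!: prob_spaceI)

interpretation unit: prob_space unit_space by (rule prob_space_unit_space)

lemma measure_unit_space:
  "A \<in> sets borel \<Longrightarrow> A \<subseteq> {0<..<1} \<Longrightarrow> measure unit_space A = measure lborel A"
  by (simp add: unit_space_def measure_restrict_space)

lemma AE_unit_space: "(AE u in unit_space. P u) \<longleftrightarrow> (AE u in lborel. u \<in> {0<..<1} \<longrightarrow> P u)"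
  unfolding unit_space_def by (subst AE_restrict_space_iff) auto

lemma AE_unit_space_countable:
  assumes "countable A"
  shows "AE u in unit_space. u \<notin> A"
proof -
  have "AE u in lborel. u \<notin> A" using assms by (rule AE_not_in[OF countable_imp_null_set_lborel])
  then show ?thesis unfolding AE_unit_space by eventually_elim auto
qed

lemma measurable_into_unit_space:
  assumes "f \<in> borel_measurable N" "\<And>x. x \<in> space N \<Longrightarrow> f x \<in> {0<..<1}"
  shows "f \<in> measurable N unit_space"
proof -
  have "f \<in> measurable N (restrict_space borel {0<..<1})"
    using assms by (intro measurable_restrict_space2) auto
  then show ?thesis by (simp cong: measurable_cong_sets add: sets_unit_space)
qed

lemma cdf_unit_space: "0 \<le> x \<Longrightarrow> x \<le> 1 \<Longrightarrow> measure unit_space {u \<in> {0<..<1}. u \<le> x} = x"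
proof -
  assume x: "0 \<le> x" "x \<le> 1"
  have "measure unit_space {u \<in> {0<..<1}. u \<le> x} = measure unit_space {0<..<x}"
    using x by (intro measure_eq_AE) (auto simp: sets_unit_space sets_restrict_space_iff
        intro!: eventually_mono[OF AE_unit_space_countable[of "{x}"]])
  also have "\<dots> = x" using x by (subst measure_unit_space) auto
  finally show ?thesis .
qed

section \<open>A uniform random variable on an atomless space\<close>

context prob_space begin

lemma atomless_uniform:
  assumes at: "atomless M"
  obtains U where "U \<in> measurable M unit_space" "distr M unit_space U = unit_space"
proof -
  obtain D :: "nat \<Rightarrow> nat \<Rightarrow> 'a set" where "D 0 1 = space M \<and>
    (\<forall>n. \<forall>k\<le>2 ^ n. D n k \<in> sets M \<and> measure M (D n k) = k / 2 ^ n \<and> D (Suc n) (2 * k) = D n k \<and>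
       (\<forall>j\<le>k. D n j \<subseteq> D n k))"
    using atomless_dyadic_chain[OF at] by (rule exE)
  then have D: "k \<le> 2 ^ n \<Longrightarrow> D n k \<in> sets M" "k \<le> 2 ^ n \<Longrightarrow> measure M (D n k) = k / 2 ^ n"
    "j \<le> k \<Longrightarrow> k \<le> 2 ^ n \<Longrightarrow> D n j \<subseteq> D n k" "k \<le> 2 ^ n \<Longrightarrow> D (Suc n) (2 * k) = D n k"
    "D 0 1 = space M" for n j k
    by simp_all
  have D2: "D (n + d) (k * 2 ^ d) = D n k" if "k \<le> 2 ^ n" for n k d
  proof (induction d)
    case (Suc d)
    have "D (Suc (n + d)) (2 * (k * 2 ^ d)) = D (n + d) (k * 2 ^ d)"
      using that by (intro D(4)) (simp add: power_add)
    then show ?case using Suc by (simp add: mult_ac)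
  qed simp
  have Dle: "D n k \<subseteq> D m j" if "k \<le> 2 ^ n" "j \<le> 2 ^ m" "real k / 2 ^ n \<le> real j / 2 ^ m" for n k m j
  proof -
    have "real k * 2 ^ m \<le> real j * 2 ^ n" using that(3) by (simp add: field_simps)
    then have "real (k * 2 ^ m) \<le> real (j * 2 ^ n)" by simp
    then have "k * 2 ^ m \<le> j * 2 ^ n" by (simp only: of_nat_le_iff)
    moreover have "j * 2 ^ n \<le> 2 ^ (n + m)" using that(2) by (simp add: power_add)
    ultimately have "D (n + m) (k * 2 ^ m) \<subseteq> D (n + m) (j * 2 ^ n)" by (rule D(3))
    then show ?thesis using D2[of k n m] D2[of j m n] that by (simp add: add.commute)
  qed
  \<comment> \<open>\<open>V w\<close> is the infimum of the dyadic levels whose set contains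
    \<open>w\<close>. Its strict sublevel sets are plain countable unions of sets
    \<open>D n k\<close>, so measurability and law are first found for
    \<open>V w < x\<close>.\<close>
  define S where "S = (\<lambda>w. {real k / 2 ^ n | n k. k \<le> 2 ^ n \<and> w \<in> D n k})"
  define V where "V = (\<lambda>w. Inf (S w))"
  have S1: "1 \<in> S w" if "w \<in> space M" for w
  proof -
    have "real 1 / 2 ^ 0 \<in> S w"
      unfolding S_def using that D(5) by (intro CollectI) (rule exI, rule exI, rule conjI[OF refl], simp)
    then show ?thesis by simp
  qed
  have Sb: "bdd_below (S w)" for w by (auto simp: S_def intro!: bdd_belowI[of _ 0])
  have "0 \<le> V w" if "w \<in> space M" for w
    unfolding V_def using S1[OF that] by (intro cInf_greatest) (auto simp: S_def)
  have Vb: "V w < x \<longleftrightarrow> (\<exists>s\<in>S w. s < x)" if "w \<in> space M" for w x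
    unfolding V_def using S1[OF that] Sb by (intro cInf_less_iff) auto
  have Vi: "V w < x \<longleftrightarrow> (\<exists>n k. k \<le> 2 ^ n \<and> real k / 2 ^ n < x \<and> w \<in> D n k)" if "w \<in> space M" for w x
    unfolding Vb[OF that] by (auto simp: S_def)
  have Ds: "w \<in> space M" if "w \<in> D n k" "k \<le> 2 ^ n" for w n k
    using sets.sets_into_space[OF D(1)[OF that(2)]] that(1) by (rule subsetD)
  have Vlt: "{w \<in> space M. V w < x} = (\<Union>n. \<Union>k\<in>{k. k \<le> 2 ^ n \<and> real k / 2 ^ n < x}. D n k)" for x
  proof (intro set_eqI iffI)
    fix w assume "w \<in> (\<Union>n. \<Union>k\<in>{k. k \<le> 2 ^ n \<and> real k / 2 ^ n < x}. D n k)"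
    then obtain n k where *: "k \<le> 2 ^ n" "real k / 2 ^ n < x" "w \<in> D n k" by blast
    have w: "w \<in> space M" using *(3,1) by (rule Ds)
    then show "w \<in> {w \<in> space M. V w < x}" using * Vi[OF w] by blast
  next
    fix w assume "w \<in> {w \<in> space M. V w < x}"
    then show "w \<in> (\<Union>n. \<Union>k\<in>{k. k \<le> 2 ^ n \<and> real k / 2 ^ n < x}. D n k)" using Vi[of w x] by blast
  qed
  have Vm: "V \<in> borel_measurable M"
    unfolding borel_measurable_iff_less Vlt using D(1) by (auto intro!: sets.countable_UN')
  have P: "measure M {w \<in> space M. V w < x} = x" if x: "0 < x" "x \<le> 1" for x
  proof -
    have ms: "{w \<in> space M. V w < x} \<in> sets M" using Vm by measurable
    \<comment> \<open>Rounding \<open>x\<close> up at level \<open>m\<close> gives a set of the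
      chain that contains the sublevel set; the preceding index lies strictly below \<open>x\<close>
      and gives one that is contained in it. Both have measure within \<open>1 / 2 ^ m\<close> of
      \<open>x\<close>.\<close>
    define j where "j = (\<lambda>m::nat. nat \<lceil>x * 2 ^ m\<rceil>)"
    have j1: "x * 2 ^ m \<le> real (j m)" "real (j m) < x * 2 ^ m + 1" for m
      unfolding j_def using x by (auto simp: of_nat_nat) linarith+
    have j2: "j m \<le> 2 ^ m" for m
    proof -
      have "x * 2 ^ m \<le> of_int (2 ^ m)" using x by simp
      then have "\<lceil>x * 2 ^ m\<rceil> \<le> 2 ^ m" by (subst ceiling_le_iff)
      then show ?thesis unfolding j_def by (simp add: nat_le_iff)
    qed
    have j3: "j m \<ge> 1" for m 
    proof -
      have "0 < x * 2 ^ m" using x by simp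
      then have "0 < real (j m)" using j1(1)[of m] by linarith
      then show ?thesis by simp
    qed
    have up: "measure M {w \<in> space M. V w < x} \<le> x + 1 / 2 ^ m" for m
    proof -
      have "{w \<in> space M. V w < x} \<subseteq> D m (j m)"
        unfolding Vlt
      proof (intro UN_least)
        fix n k assume k: "k \<in> {k. k \<le> 2 ^ n \<and> real k / 2 ^ n < x}"
        have "x \<le> real (j m) / 2 ^ m" using j1(1)[of m] by (simp add: le_divide_eq)
        then have "real k / 2 ^ n \<le> real (j m) / 2 ^ m" using k by simp
        then show "D n k \<subseteq> D m (j m)" using k j2 by (intro Dle) auto
      qed
      then have "measure M {w \<in> space M. V w < x} \<le> measure M (D m (j m))"
        using D(1) j2 by (intro finite_measure_mono) auto
      also have "\<dots> \<le> x + 1 / 2 ^ m" using j1(2)[of m] j2 by (simp add: D(2) field_simps)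
      finally show ?thesis .
    qed
    have lo: "x - 1 / 2 ^ m \<le> measure M {w \<in> space M. V w < x}" for m
    proof -
      have e: "real (j m - 1) = real (j m) - 1" using j3[of m] by simp
      have "real (j m - 1) / 2 ^ m < x" using j1(2)[of m] e by (simp add: field_simps)
      then have "D m (j m - 1) \<subseteq> {w \<in> space M. V w < x}"
        unfolding Vlt using j2[of m] by (intro subsetI, intro UN_I[of m] UN_I[of "j m - 1"]) auto
      then have "measure M (D m (j m - 1)) \<le> measure M {w \<in> space M. V w < x}"
        using ms by (intro finite_measure_mono) auto
      moreover have "measure M (D m (j m - 1)) = real (j m - 1) / 2 ^ m" using j2[of m] by (intro D(2)) simp
      moreover have "x - 1 / 2 ^ m \<le> real (j m - 1) / 2 ^ m" using j1(1)[of m] e by (simp add: field_simps)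
      ultimately show ?thesis by linarith
    qed
    have l: "(\<lambda>m. 1 / 2 ^ m :: real) \<longlonglongrightarrow> 0"
      using LIMSEQ_power_zero[of "1 / 2 :: real"] by (simp add: power_one_over)
    have "(\<lambda>m. x + 1 / 2 ^ m) \<longlonglongrightarrow> x + 0" "(\<lambda>m. x - 1 / 2 ^ m) \<longlonglongrightarrow> x - 0"
      by (intro tendsto_intros l)+
    then have "measure M {w \<in> space M. V w < x} \<le> x + 0" "x - 0 \<le> measure M {w \<in> space M. V w < x}"
      using up lo by (auto intro: LIMSEQ_le_const LIMSEQ_le_const2)
    then show ?thesis by simp
  qed
  have P': "measure M {w \<in> space M. V w \<le> x} = x" if x: "0 \<le> x" "x < 1" for x
  proof (rule antisym)
    have "measure M {w \<in> space M. V w \<le> x} \<le> x + e" if "0 < e" for e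
    proof -
      have "measure M {w \<in> space M. V w \<le> x} \<le> measure M {w \<in> space M. V w < min 1 (x + e)}"
        using that x Vm by (intro finite_measure_mono) auto
      also have "\<dots> \<le> x + e" using that x by (subst P) auto
      finally show ?thesis .
    qed
    then show "measure M {w \<in> space M. V w \<le> x} \<le> x" by (rule field_le_epsilon)
    show "x \<le> measure M {w \<in> space M. V w \<le> x}"
    proof (cases "x = 0")
      case False
      then have "x = measure M {w \<in> space M. V w < x}" using x P by simp
      also have "\<dots> \<le> measure M {w \<in> space M. V w \<le> x}"
        using Vm by (intro finite_measure_mono) auto
      finally show ?thesis .
    qed simp
  qed
  \<comment> \<open>\<open>U\<close> has to map every point into the open interval. \<open>V\<close>
    leaves it only on a null set, where the value 1/2 is arbitrary.\<close>
  define U where "U = (\<lambda>w. if 0 < V w \<and> V w < 1 then V w else 1 / 2)"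
  have Um: "U \<in> borel_measurable M" unfolding U_def using Vm by measurable
  have UV: "AE w in M. U w = V w"
  proof -
    have "AE w in M. w \<in> {w \<in> space M. V w < 1}" using P[of 1] by (intro AE_prob_1) simp
    moreover have "{w \<in> space M. V w \<le> 0} \<in> null_sets M"
      using P'[of 0] Vm by (simp add: null_sets_def emeasure_eq_measure)
    then have "AE w in M. w \<notin> {w \<in> space M. V w \<le> 0}" by (rule AE_not_in)
    ultimately show ?thesis by eventually_elim (auto simp: U_def)
  qed
  have U1: "U \<in> measurable M unit_space"
    using Um by (rule measurable_into_unit_space) (auto simp: U_def)
  have rd: "real_distribution (distr M borel U)"
    using Um by (rule real_distribution_distr)
  have rd2: "real_distribution (distr unit_space borel (\<lambda>x. x))"
    by (rule unit.real_distribution_distr) simp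
  have eq: "distr M borel U = distr unit_space borel (\<lambda>x. x)"
  proof (rule cdf_unique[OF rd rd2], rule ext)
    fix x
    have a: "cdf (distr M borel U) x = measure M {w \<in> space M. U w \<le> x}"
      using Um by (simp add: cdf_def measure_distr vimage_def Int_def conj_commute)
    have b: "cdf (distr unit_space borel (\<lambda>x. x)) x = measure unit_space {u \<in> {0<..<1}. u \<le> x}"
      by (simp add: cdf_def measure_distr vimage_def Int_def conj_commute)
    have U01: "0 < U w" "U w < 1" for w by (auto simp: U_def)
    consider "x < 0" | "x \<ge> 1" | "0 \<le> x" "x < 1" by linarith
    then show "cdf (distr M borel U) x = cdf (distr unit_space borel (\<lambda>x. x)) x"
    proof cases
      case 1
      then have "\<not> U w \<le> x" for w using U01(1)[of w] by linarith
      then have e: "{w \<in> space M. U w \<le> x} = {}" by simp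
      have "{u \<in> {0<..<1}. u \<le> x} = {}" using 1 by auto
      then show ?thesis unfolding a b e by (simp only: measure_empty)
    next
      case 2
      then have "U w \<le> x" for w using U01(2)[of w] by linarith
      then have e: "{w \<in> space M. U w \<le> x} = space M" by simp
      have "{u \<in> {0<..<1}. u \<le> x} = space unit_space" using 2 by auto
      then show ?thesis unfolding a b e using prob_space unit.prob_space by simp
    next
      case 3
      have "measure M {w \<in> space M. U w \<le> x} = measure M {w \<in> space M. V w \<le> x}"
        using UV Um Vm by (intro measure_eq_AE) (auto elim!: eventually_mono)
      then show ?thesis unfolding a b using P' 3 cdf_unit_space by simp
    qed
  qed
  have "distr M unit_space U = unit_space"
  proof (rule measure_eqI)
    fix A assume "A \<in> sets (distr M unit_space U)"
    then have A: "A \<in> sets unit_space" by simp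
    then have A': "A \<in> sets borel" "A \<subseteq> {0<..<1}"
      by (auto simp: sets_unit_space sets_restrict_space)
    have "emeasure (distr M unit_space U) A = emeasure (distr M borel U) A"
      using A A' U1 Um by (simp add: emeasure_distr)
    also have "\<dots> = emeasure unit_space A"
      unfolding eq using A' by (subst emeasure_distr) (auto intro!: arg_cong[where f="emeasure unit_space"])
    finally show "emeasure (distr M unit_space U) A = emeasure unit_space A" .
  qed simp
  then show thesis by (rule that[OF U1])
qed

end

section \<open>Super-linear expectations and rotations of an interval\<close>

lemma bounded_rvsI:
  "X \<in> borel_measurable M \<Longrightarrow> (AE w in M. \<bar>X w\<bar> \<le> K) \<Longrightarrow> X \<in> bounded_rvs M"
  unfolding bounded_rvs_def by blast

lemma bounded_rvs_measurable: "X \<in> bounded_rvs M \<Longrightarrow> X \<in> borel_measurable M"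
  by (simp add: bounded_rvs_def)

lemma bounded_rvs_const: "(\<lambda>_. a) \<in> bounded_rvs M"
  by (rule bounded_rvsI[of _ _ "\<bar>a\<bar>"]) auto

lemma bounded_rvs_add:
  assumes "X \<in> bounded_rvs M" "Y \<in> bounded_rvs M"
  shows "(\<lambda>w. X w + Y w) \<in> bounded_rvs M"
proof -
  obtain K L where K: "AE w in M. \<bar>X w\<bar> \<le> K" and L: "AE w in M. \<bar>Y w\<bar> \<le> L"
    using assms unfolding bounded_rvs_def by blast
  show ?thesis
  proof (rule bounded_rvsI)
    show "AE w in M. \<bar>X w + Y w\<bar> \<le> K + L" using K L by eventually_elim linarith
  qed (use assms[THEN bounded_rvs_measurable] in measurable)
qed

lemma bounded_rvs_scale:
  assumes "X \<in> bounded_rvs M"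
  shows "(\<lambda>w. r * X w) \<in> bounded_rvs M"
proof -
  obtain K where K: "AE w in M. \<bar>X w\<bar> \<le> K"
    using assms unfolding bounded_rvs_def by blast
  show ?thesis
  proof (rule bounded_rvsI)
    show "AE w in M. \<bar>r * X w\<bar> \<le> \<bar>r\<bar> * K"
      using K by eventually_elim (simp add: abs_mult mult_left_mono)
  qed (use assms[THEN bounded_rvs_measurable] in measurable)
qed

lemma bounded_rvs_sum:
  "(\<And>k. k < n \<Longrightarrow> X k \<in> bounded_rvs M) \<Longrightarrow> (\<lambda>w. \<Sum>k<(n::nat). X k w) \<in> bounded_rvs M"
  by (induction n) (auto intro: bounded_rvs_const bounded_rvs_add)

context
  fixes M :: "'a measure" and E :: "('a \<Rightarrow> real) \<Rightarrow> real"
  assumes E: "superlinear_expectation M E"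
begin

lemma superlinear_mono:
  "X \<in> bounded_rvs M \<Longrightarrow> Y \<in> bounded_rvs M \<Longrightarrow> AE w in M. X w \<le> Y w \<Longrightarrow> E X \<le> E Y"
  using E unfolding superlinear_expectation_def nonlinear_expectation_def by blast

lemma superlinear_const: "E (\<lambda>_. a) = a"
  using E unfolding superlinear_expectation_def nonlinear_expectation_def by blast

lemma superlinear_law:
  "X \<in> bounded_rvs M \<Longrightarrow> Y \<in> bounded_rvs M \<Longrightarrow> distr M borel X = distr M borel Y \<Longrightarrow> E X = E Y"
  using E unfolding superlinear_expectation_def nonlinear_expectation_def eq_law_def by blast

lemma superlinear_add:
  "X \<in> bounded_rvs M \<Longrightarrow> Y \<in> bounded_rvs M \<Longrightarrow> E X + E Y \<le> E (\<lambda>w. X w + Y w)"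
  using E unfolding superlinear_expectation_def by blast

lemma superlinear_scale:
  "X \<in> bounded_rvs M \<Longrightarrow> 0 \<le> r \<Longrightarrow> E (\<lambda>w. r * X w) = r * E X"
  using E unfolding superlinear_expectation_def by blast

text \<open>Super-additivity with the constant \<open>- a\<close> bounds
  \<open>E (\<lambda>w. Y w + a)\<close> by \<open>E Y + a\<close>. This provides continuity of
  \<open>E\<close> under uniform approximation.\<close>

lemma superlinear_le_add_const:
  assumes "X \<in> bounded_rvs M" "Y \<in> bounded_rvs M" "AE w in M. X w \<le> Y w + a"
  shows "E X \<le> E Y + a"
proof -
  have Ya: "(\<lambda>w. Y w + a) \<in> bounded_rvs M"
    using assms(2) bounded_rvs_const by (rule bounded_rvs_add)
  have "E X \<le> E (\<lambda>w. Y w + a)" using assms(1) Ya assms(3) by (rule superlinear_mono)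
  moreover have "E (\<lambda>w. Y w + a) + E (\<lambda>_. - a) \<le> E (\<lambda>w. (Y w + a) + - a)"
    using Ya bounded_rvs_const by (rule superlinear_add)
  ultimately show ?thesis by (simp add: superlinear_const)
qed

lemma superlinear_sum:
  "(\<And>k. k < n \<Longrightarrow> X k \<in> bounded_rvs M) \<Longrightarrow> (\<Sum>k<(n::nat). E (X k)) \<le> E (\<lambda>w. \<Sum>k<n. X k w)"
proof (induction n)
  case 0
  then show ?case by (simp add: superlinear_const)
next
  case (Suc n)
  have "E (\<lambda>w. \<Sum>k<n. X k w) + E (X n) \<le> E (\<lambda>w. (\<Sum>k<n. X k w) + X n w)"
    using Suc.prems by (intro superlinear_add bounded_rvs_sum) auto
  then show ?case using Suc.IH Suc.prems by fastforce
qed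

lemma superlinear_convex:
  assumes "X \<in> bounded_rvs M" "Y \<in> bounded_rvs M" "0 \<le> t" "t \<le> 1"
  shows "(1 - t) * E X + t * E Y \<le> E (\<lambda>w. (1 - t) * X w + t * Y w)"
proof -
  have "E (\<lambda>w. (1 - t) * X w) + E (\<lambda>w. t * Y w) \<le> E (\<lambda>w. (1 - t) * X w + t * Y w)"
    using assms by (intro superlinear_add bounded_rvs_scale)
  then show ?thesis using assms by (simp add: superlinear_scale)
qed

lemma superlinear_convex_le:
  assumes "X \<in> bounded_rvs M" "Y \<in> bounded_rvs M" "0 \<le> t" "t \<le> 1" "a \<le> E X" "a \<le> E Y"
  shows "a \<le> E (\<lambda>w. (1 - t) * X w + t * Y w)"
proof -
  have "a = (1 - t) * a + t * a" by (simp add: algebra_simps)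
  also have "\<dots> \<le> (1 - t) * E X + t * E Y" using assms by (intro add_mono mult_left_mono) auto
  also have "\<dots> \<le> E (\<lambda>w. (1 - t) * X w + t * Y w)" using assms by (intro superlinear_convex)
  finally show ?thesis .
qed

end

section \<open>Transport along measure preserving maps\<close>

lemma bounded_rvs_transport:
  assumes T: "T \<in> measurable M N" "distr M N T = N" and f: "f \<in> bounded_rvs N"
  shows "(\<lambda>w. f (T w)) \<in> bounded_rvs M"
proof -
  obtain K where "AE x in N. \<bar>f x\<bar> \<le> K" using f unfolding bounded_rvs_def by blast
  then have "AE x in distr M N T. \<bar>f x\<bar> \<le> K" unfolding T(2) .
  then have "AE w in M. \<bar>f (T w)\<bar> \<le> K" using T(1) by (auto dest: AE_distrD[rotated])
  moreover have "(\<lambda>w. f (T w)) \<in> borel_measurable M"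
    using bounded_rvs_measurable[OF f] T(1) by measurable
  ultimately show ?thesis by (auto intro: bounded_rvsI)
qed

lemma distr_transport:
  assumes T: "T \<in> measurable M N" "distr M N T = N" and f: "f \<in> measurable N L"
  shows "distr M L (\<lambda>w. f (T w)) = distr N L f"
  using distr_distr[OF f T(1)] unfolding T(2) by (simp add: comp_def)

text \<open>Law invariance survives because composing with \<open>T\<close> does not change laws.
  With a uniform variable for \<open>T\<close>, the problem moves to the unit interval.\<close>

lemma superlinear_transport:
  assumes T: "T \<in> measurable M N" "distr M N T = N" and E: "superlinear_expectation M E"
  shows "superlinear_expectation N (\<lambda>f. E (\<lambda>w. f (T w)))"
proof -
  note b = bounded_rvs_transport[OF T]
  have mono: "E (\<lambda>w. f (T w)) \<le> E (\<lambda>w. g (T w))"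
    if "f \<in> bounded_rvs N" "g \<in> bounded_rvs N" "AE x in N. f x \<le> g x" for f g
  proof (rule superlinear_mono[OF E b b])
    have "AE x in distr M N T. f x \<le> g x" using that(3) unfolding T(2) .
    then show "AE w in M. f (T w) \<le> g (T w)" by (rule AE_distrD[OF T(1)])
  qed (fact that)+
  have law: "E (\<lambda>w. f (T w)) = E (\<lambda>w. g (T w))"
    if "f \<in> bounded_rvs N" "g \<in> bounded_rvs N" "eq_law N f g" for f g
    using that bounded_rvs_measurable[OF that(1)] bounded_rvs_measurable[OF that(2)]
    by (intro superlinear_law[OF E b b]) (simp_all add: distr_transport[OF T] eq_law_def)
  show ?thesis
    unfolding superlinear_expectation_def nonlinear_expectation_def
    using mono law superlinear_const[OF E] superlinear_add[OF E b b] superlinear_scale[OF E b]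
    by auto
qed

section \<open>Bounded functions and rotations on the unit interval\<close>

lemma bounded_rvs_unit:
  fixes B :: real
  shows "f \<in> borel_measurable unit_space \<Longrightarrow> (\<And>u. 0 < u \<Longrightarrow> u < 1 \<Longrightarrow> \<bar>f u\<bar> \<le> B) \<Longrightarrow> f \<in> bounded_rvs unit_space"
  by (rule bounded_rvsI[of _ _ B]) auto

lemma integrable_unit:
  fixes f :: "real \<Rightarrow> real"
  assumes "f \<in> borel_measurable unit_space" "\<And>u. 0 < u \<Longrightarrow> u < 1 \<Longrightarrow> \<bar>f u\<bar> \<le> B"
  shows "integrable unit_space f"
  using assms by (intro unit.integrable_const_bound[of _ B]) auto

lemma integrable_unit_indicator:
  fixes f :: "real \<Rightarrow> real"
  assumes "f \<in> borel_measurable unit_space" "\<And>u. 0 < u \<Longrightarrow> u < 1 \<Longrightarrow> \<bar>f u\<bar> \<le> B" and A: "A \<in> sets borel"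
  shows "integrable unit_space (\<lambda>u. f u * indicator A u)"
proof (rule integrable_unit)
  show "(\<lambda>u. f u * indicator A u) \<in> borel_measurable unit_space"
    using assms(1) measurable_unit_space[OF borel_measurable_indicator[OF A]]
    by (rule borel_measurable_times)
  fix u :: real assume "0 < u" "u < 1"
  then show "\<bar>f u * indicator A u\<bar> \<le> max B 0" using assms(2)[of u] by (auto simp: indicator_def)
qed

lemma integral_unit_indicator:
  assumes "0 \<le> a" "a \<le> b" "b \<le> 1"
  shows "(\<integral>u. c * indicator {a..<b} u \<partial>unit_space) = c * (b - a)"
proof -
  \<comment> \<open>\<open>a\<close> may be 0, which is not a point of the space; without its left
    end point the cell is a subset of the space.\<close>
  have "(\<integral>u. c * indicator {a..<b} u \<partial>unit_space) = (\<integral>u. c * indicator {a<..<b} u \<partial>unit_space)"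
  proof (rule integral_cong_AE)
    show "AE u in unit_space. c * indicator {a..<b} u = c * indicator {a<..<b} u"
      using AE_unit_space_countable[of "{a}", simplified] by eventually_elim (auto simp: indicator_def)
  qed (auto intro!: borel_measurable_times measurable_unit_space)
  also have "\<dots> = c * (\<integral>u. indicator {a<..<b} u \<partial>unit_space)" by simp
  also have "(\<integral>u. indicator {a<..<b} u \<partial>unit_space) = measure unit_space ({a<..<b} \<inter> space unit_space)"
    by simp
  also have "{a<..<b} \<inter> space unit_space = {a<..<b}" using assms by auto
  also have "measure unit_space {a<..<b} = b - a" using assms by (subst measure_unit_space) auto
  finally show ?thesis .
qed

text \<open>The two points on which the translation is ambiguous stay fixed; they form a null set.\<close>

definition rot :: "real \<Rightarrow> real \<Rightarrow> real \<Rightarrow> real \<Rightarrow> real" where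
  "rot a b s u = (if a < u \<and> u < b - s then u + s else if b - s < u \<and> u < b then u + s - (b - a) else u)"

lemma emeasure_lborel_translate:
  fixes B :: "real set"
  assumes "B \<in> sets borel"
  shows "emeasure lborel {u. u + c \<in> B} = emeasure lborel B"
proof -
  have "emeasure lborel B = emeasure (distr lborel borel ((+) c)) B" by (simp add: lborel_distr_plus)
  also have "\<dots> = emeasure lborel {u. u + c \<in> B}"
    using assms by (subst emeasure_distr) (auto simp: vimage_def add.commute)
  finally show ?thesis by simp
qed

text \<open>Each branch of \<open>rot\<close> is a translation. \<open>P1\<close> and
  \<open>P2\<close> are the parts of the preimage that are moved right and left, \<open>P3\<close>
  is the part that stays fixed; the images of the two moved parts fill the interval up to its end
  points and \<open>a + s\<close>.\<close>

lemma emeasure_lborel_rot: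
  assumes ab: "0 \<le> s" "s \<le> b - a" and A: "A \<in> sets borel"
  shows "emeasure lborel (rot a b s -` A) = emeasure lborel A"
proof -
  define P1 where "P1 = {u. u + s \<in> A \<inter> {a + s<..<b}}"
  define P2 where "P2 = {u. u + (s - (b - a)) \<in> A \<inter> {a<..<a + s}}"
  define P3 where "P3 = A - ({a<..<b - s} \<union> {b - s<..<b})"
  define Q3 where "Q3 = A - ({a + s<..<b} \<union> {a<..<a + s})"
  have e1: "emeasure lborel P1 = emeasure lborel (A \<inter> {a + s<..<b})"
    unfolding P1_def using A by (intro emeasure_lborel_translate) auto
  have e2: "emeasure lborel P2 = emeasure lborel (A \<inter> {a<..<a + s})"
    unfolding P2_def using A by (intro emeasure_lborel_translate) auto
  have m1: "P1 \<in> sets borel" "P2 \<in> sets borel" using A unfolding P1_def P2_def by measurable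
  have m3: "P3 \<in> sets borel" "Q3 \<in> sets borel" using A unfolding P3_def Q3_def by auto
  \<comment> \<open>The two sets can differ only at the cut of the domain, \<open>b - s\<close>, and
    at the cut of the image, \<open>a + s\<close>.\<close>
  have e3: "emeasure lborel P3 = emeasure lborel Q3"
  proof (rule emeasure_eq_AE)
    have "AE u in lborel. u \<notin> {a + s, b - s, a, b}"
      by (intro AE_not_in countable_imp_null_set_lborel) auto
    then show "AE u in lborel. u \<in> P3 \<longleftrightarrow> u \<in> Q3"
      by eventually_elim (use ab in \<open>auto simp: P3_def Q3_def\<close>)
  qed (use m3 in auto)
  have "rot a b s -` A = (P1 \<union> P2) \<union> P3"
  proof (rule set_eqI)
    fix u
    consider "a < u \<and> u < b - s" | "b - s < u \<and> u < b" | "\<not> (a < u \<and> u < b - s)" "\<not> (b - s < u \<and> u < b)" by blast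
    then show "u \<in> rot a b s -` A \<longleftrightarrow> u \<in> (P1 \<union> P2) \<union> P3"
      using ab by cases (auto simp: P1_def P2_def P3_def rot_def algebra_simps)
  qed
  then have "emeasure lborel (rot a b s -` A) = emeasure lborel ((P1 \<union> P2) \<union> P3)" by simp
  also have "\<dots> = emeasure lborel (P1 \<union> P2) + emeasure lborel P3"
    using m1 m3 ab by (intro plus_emeasure[symmetric]) (auto simp: P1_def P2_def P3_def)
  also have "emeasure lborel (P1 \<union> P2) = emeasure lborel P1 + emeasure lborel P2"
    using m1 ab by (intro plus_emeasure[symmetric]) (auto simp: P1_def P2_def)
  also have "emeasure lborel P1 + emeasure lborel P2 =
      emeasure lborel ((A \<inter> {a + s<..<b}) \<union> (A \<inter> {a<..<a + s}))"
    unfolding e1 e2 using A by (intro plus_emeasure) auto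
  also have "emeasure lborel ((A \<inter> {a + s<..<b}) \<union> (A \<inter> {a<..<a + s})) + emeasure lborel P3 =
      emeasure lborel (((A \<inter> {a + s<..<b}) \<union> (A \<inter> {a<..<a + s})) \<union> Q3)"
    unfolding e3 using A m3 by (intro plus_emeasure) (auto simp: Q3_def)
  also have "((A \<inter> {a + s<..<b}) \<union> (A \<inter> {a<..<a + s})) \<union> Q3 = A" by (auto simp: Q3_def)
  finally show ?thesis .
qed

lemma rot_unit_space:
  assumes ab: "0 \<le> a" "b \<le> 1" "0 \<le> s" "s \<le> b - a"
  shows "rot a b s \<in> measurable unit_space unit_space" "distr unit_space unit_space (rot a b s) = unit_space"
proof -
  have "rot a b s \<in> borel_measurable borel" unfolding rot_def[abs_def] by measurable
  then have m: "rot a b s \<in> borel_measurable unit_space" by (rule measurable_unit_space)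
  show 1: "rot a b s \<in> measurable unit_space unit_space"
    using m by (rule measurable_into_unit_space) (use ab in \<open>auto simp: rot_def\<close>)
  have inv: "rot a b s u \<in> {0<..<1} \<longleftrightarrow> u \<in> {0<..<1}" for u
    using ab by (auto simp: rot_def)
  show "distr unit_space unit_space (rot a b s) = unit_space"
  proof (rule measure_eqI)
    fix A assume "A \<in> sets (distr unit_space unit_space (rot a b s))"
    then have A: "A \<in> sets unit_space" by simp
    then have A': "A \<in> sets borel" "A \<subseteq> {0<..<1}"
      by (auto simp: sets_unit_space sets_restrict_space)
    have sub: "rot a b s -` A \<subseteq> {0<..<1}" using inv A'(2) by blast
    then have eq: "rot a b s -` A \<inter> space unit_space = rot a b s -` A" by auto
    have lb: "emeasure unit_space C = emeasure lborel C" if "C \<subseteq> {0<..<1}" for C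
      unfolding unit_space_def using that by (intro emeasure_restrict_space) auto
    have "emeasure (distr unit_space unit_space (rot a b s)) A = emeasure unit_space (rot a b s -` A)"
      using A 1 eq by (simp add: emeasure_distr)
    also have "\<dots> = emeasure unit_space A"
      unfolding lb[OF sub] lb[OF A'(2)] using ab A' by (intro emeasure_lborel_rot) auto
    finally show "emeasure (distr unit_space unit_space (rot a b s)) A = emeasure unit_space A" .
  qed simp
qed

text \<open>Rotations permute the cells cyclically; hence a sum along an orbit does not depend on
  the cell in which it starts.\<close>

lemma sum_mod_shift:
  fixes F :: "nat \<Rightarrow> real"
  assumes "j < n"
  shows "(\<Sum>k<n. F ((j + k) mod n)) = (\<Sum>k<n. F k)"
proof -
  have inj: "inj_on (\<lambda>k. (j + k) mod n) {..<n}"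
  proof (rule inj_onI)
    fix k l assume kl: "k \<in> {..<n}" "l \<in> {..<n}" "(j + k) mod n = (j + l) mod n"
    have "(j + i) mod n = (if j + i < n then j + i else j + i - n)" if "i < n" for i
      using assms that by (auto simp: le_mod_geq)
    then show "k = l" using kl assms by (auto split: if_splits)
  qed
  have "(\<lambda>k. (j + k) mod n) ` {..<n} = {..<n}"
    using assms by (intro endo_inj_surj[OF _ _ inj]) auto
  then show ?thesis using sum.reindex[OF inj, of F] by (simp add: comp_def)
qed

section \<open>Averaging over an interval\<close>

lemma integral_indicator_cells:
  fixes f :: "real \<Rightarrow> real" and p :: "nat \<Rightarrow> real"
  assumes f: "f \<in> borel_measurable unit_space" "\<And>u. 0 < u \<Longrightarrow> u < 1 \<Longrightarrow> \<bar>f u\<bar> \<le> B"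
    and p: "\<And>i. i < n \<Longrightarrow> p i \<le> p (Suc i)"
  shows "(\<Sum>i<n. \<integral>u. f u * indicator {p i..<p (Suc i)} u \<partial>unit_space) =
    (\<integral>u. f u * indicator {p 0..<p n} u \<partial>unit_space)"
  using p
proof (induction n)
  case (Suc n)
  note p' = Suc.prems
  have "p 0 \<le> p i" if "i \<le> n" for i
    using that
  proof (induction i)
    case (Suc i)
    then show ?case using Suc.prems by (intro order_trans[OF Suc.IH p']) auto
  qed simp
  then have le: "p 0 \<le> p n" by simp
  have "(\<Sum>i<Suc n. \<integral>u. f u * indicator {p i..<p (Suc i)} u \<partial>unit_space) =
      (\<integral>u. f u * indicator {p 0..<p n} u \<partial>unit_space) + (\<integral>u. f u * indicator {p n..<p (Suc n)} u \<partial>unit_space)"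
    using Suc by simp
  also have "\<dots> = (\<integral>u. f u * indicator {p 0..<p n} u + f u * indicator {p n..<p (Suc n)} u \<partial>unit_space)"
    using f by (intro Bochner_Integration.integral_add[symmetric] integrable_unit_indicator) auto
  also have "\<dots> = (\<integral>u. f u * indicator {p 0..<p (Suc n)} u \<partial>unit_space)"
    using le Suc.prems[of n] by (intro Bochner_Integration.integral_cong refl) (auto simp: indicator_def)
  finally show ?case .
qed simp

lemma cell_integral_ge:
  fixes f :: "real \<Rightarrow> real"
  assumes f: "f \<in> borel_measurable unit_space" "\<And>u. 0 < u \<Longrightarrow> u < 1 \<Longrightarrow> \<bar>f u\<bar> \<le> B"
    and ab: "0 \<le> a" "a \<le> b" "b \<le> 1" and c: "\<And>u. a < u \<Longrightarrow> u < b \<Longrightarrow> c \<le> f u"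
  shows "c * (b - a) \<le> (\<integral>u. f u * indicator {a..<b} u \<partial>unit_space)"
proof -
  have "(\<integral>u. c * indicator {a..<b} u \<partial>unit_space) \<le> (\<integral>u. f u * indicator {a..<b} u \<partial>unit_space)"
  proof (rule integral_mono_AE)
    show "integrable unit_space (\<lambda>u. c * indicator {a..<b} u)"
      by (rule integrable_unit_indicator[of _ "\<bar>c\<bar>"]) auto
    show "integrable unit_space (\<lambda>u. f u * indicator {a..<b} u)"
      using f by (rule integrable_unit_indicator) auto
    show "AE u in unit_space. c * indicator {a..<b} u \<le> f u * indicator {a..<b} u"
      using AE_unit_space_countable[of "{a}", simplified] by eventually_elim (use c in \<open>auto simp: indicator_def\<close>)
  qed
  then show ?thesis unfolding integral_unit_indicator[OF ab] .
qed

lemma cell_integral_le: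
  fixes f :: "real \<Rightarrow> real"
  assumes f: "f \<in> borel_measurable unit_space" "\<And>u. 0 < u \<Longrightarrow> u < 1 \<Longrightarrow> \<bar>f u\<bar> \<le> B"
    and ab: "0 \<le> a" "a \<le> b" "b \<le> 1" and c: "\<And>u. a < u \<Longrightarrow> u < b \<Longrightarrow> f u \<le> c"
  shows "(\<integral>u. f u * indicator {a..<b} u \<partial>unit_space) \<le> c * (b - a)"
proof -
  have "- c * (b - a) \<le> (\<integral>u. - f u * indicator {a..<b} u \<partial>unit_space)"
    using f ab c by (intro cell_integral_ge[of _ B]) auto
  then show ?thesis by simp
qed

text \<open>The rotations by multiples of \<open>(b - a) / n\<close> move \<open>u\<close> once into each of the \<open>n\<close> cells of
  \<open>{a..<b}\<close>, and on a cell \<open>f\<close> is at most its mean over the next cell.\<close>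

lemma rot_average_le:
  fixes f :: "real \<Rightarrow> real"
  assumes f: "f \<in> borel_measurable unit_space" "\<And>u. 0 < u \<Longrightarrow> u < 1 \<Longrightarrow> \<bar>f u\<bar> \<le> B"
    and ab: "0 \<le> a" "a < b" "b \<le> 1" and mono: "\<And>u v. a < u \<Longrightarrow> u \<le> v \<Longrightarrow> v < b \<Longrightarrow> f u \<le> f v"
    and n: "n > 0" and u: "a < u" "u < b" "\<And>j. j \<le> n \<Longrightarrow> u \<noteq> a + real j * ((b - a) / n)"
  shows "(\<Sum>k<n. f (rot a b (real k * ((b - a) / n)) u)) / n \<le>
    (\<integral>u. f u * indicator {a..<b} u \<partial>unit_space) / (b - a) + 2 * B / n"
proof -
  define d where "d = (b - a) / n"
  have d: "0 < d" "n * d = b - a" unfolding d_def using ab n by auto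
  have u': "u \<noteq> a + real j * d" if "j \<le> n" for j using u(3)[OF that] unfolding d_def .
  \<comment> \<open>\<open>j0\<close> is the cell of \<open>u\<close> and \<open>v\<close> the
    offset of \<open>u\<close> inside it. A rotation by \<open>real k * d\<close> keeps the offset
    and shifts the cell cyclically by \<open>k\<close>, so that the orbit consists of the points
    with offset \<open>v\<close> in all the cells.\<close>
  define j0 where "j0 = nat \<lfloor>(u - a) / d\<rfloor>"
  define v where "v = u - a - j0 * d"
  have "real j0 = of_int \<lfloor>(u - a) / d\<rfloor>" unfolding j0_def using u d by simp
  then have fl: "real j0 \<le> (u - a) / d" "(u - a) / d < real j0 + 1" by linarith+
  then have j0: "real j0 * d \<le> u - a" "u - a < real j0 * d + d"
    using d by (simp_all add: field_simps)
  have "real j0 * d < n * d" using j0 u d by linarith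
  then have "real j0 < real n" using d(1) by (simp only: mult_less_cancel_right_pos)
  then have jn: "j0 < n" by simp
  have v: "0 < v" "v < d" using j0 u'[of j0] jn by (auto simp: v_def)
  define F where "F = (\<lambda>j::nat. f (a + real j * d + v))"
  have dn: "real j * d + d \<le> b - a" if "j < n" for j
  proof -
    have "real (Suc j) * d \<le> real n * d" using that d by (intro mult_right_mono) auto
    then show ?thesis using d by (simp add: algebra_simps)
  qed
  have rotk: "f (rot a b (real k * d) u) = F ((j0 + k) mod n)" if k: "k < n" for k
  proof (cases "j0 + k < n")
    case True
    have "u + real k * d = a + real (j0 + k) * d + v" by (simp add: v_def algebra_simps)
    moreover have "u + real k * d < b" using dn[OF True] v(2) calculation by linarith
    ultimately show ?thesis using True u by (simp add: rot_def F_def)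
  next
    case False
    then have m: "(j0 + k) mod n = j0 + k - n" using k jn by (simp add: le_mod_geq)
    have r: "real (j0 + k - n) = real j0 + real k - real n" using False by simp
    have e: "u + real k * d - (b - a) = a + real (j0 + k - n) * d + v"
      unfolding r d(2)[symmetric] by (simp add: v_def algebra_simps)
    have "0 \<le> real (j0 + k - n) * d" using d by simp
    then have "b < u + real k * d" using e v(1) by linarith
    then have "rot a b (real k * d) u = u + real k * d - (b - a)" using u by (simp add: rot_def)
    then show ?thesis unfolding e m F_def by simp
  qed
  define J where "J = (\<lambda>j::nat. \<integral>u. f u * indicator {a + real j * d..<a + real (Suc j) * d} u \<partial>unit_space)"
  have Jsum: "(\<Sum>j<n. J j) = (\<integral>u. f u * indicator {a..<b} u \<partial>unit_space)"
    using integral_indicator_cells[OF f, of n "\<lambda>j. a + real j * d"] d unfolding J_def by (simp add: algebra_simps)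
  \<comment> \<open>The point with offset \<open>v\<close> in cell \<open>j\<close> lies to the left
    of the whole cell \<open>Suc j\<close>.\<close>
  have FJ: "d * F j \<le> J (Suc j)" if "Suc j < n" for j
  proof -
    have "F j * ((a + real (Suc (Suc j)) * d) - (a + real (Suc j) * d)) \<le> J (Suc j)"
      unfolding J_def
    proof (rule cell_integral_ge[OF f])
      show "0 \<le> a + real (Suc j) * d" using ab d by simp
      show "a + real (Suc j) * d \<le> a + real (Suc (Suc j)) * d" using d by simp
      show "a + real (Suc (Suc j)) * d \<le> 1" using dn[OF that] ab by (simp add: algebra_simps)
      fix w assume w: "a + real (Suc j) * d < w" "w < a + real (Suc (Suc j)) * d"
      have e: "real (Suc j) * d = real j * d + d" "real (Suc (Suc j)) * d = real (Suc j) * d + d"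
        by (simp_all add: algebra_simps)
      define y where "y = real j * d"
      have y: "0 \<le> y" "a + (y + d) < w" "w < a + (y + d + d)" "y + d + d \<le> b - a"
        using d w dn[OF that] unfolding e y_def by simp_all
      have "f (a + y + v) \<le> f w" using y v by (intro mono) linarith+
      then show "F j \<le> f w" unfolding F_def y_def .
    qed
    then show ?thesis by (simp add: algebra_simps)
  qed
  have B: "0 \<le> B" using f(2)[of "1/2"] by simp
  have Fb: "F j \<le> B" if "j < n" for j
  proof -
    have "0 \<le> real j * d" using d by simp
    then have "\<bar>F j\<bar> \<le> B" unfolding F_def using dn[OF that] v ab by (intro f(2)) linarith+
    then show ?thesis by simp
  qed
  have J0: "- B * d \<le> J 0"
  proof -
    have "- B * ((a + real (Suc 0) * d) - (a + real 0 * d)) \<le> J 0"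
      unfolding J_def
    proof (rule cell_integral_ge[OF f])
      show "a + real (Suc 0) * d \<le> 1" using dn[of 0] n ab by simp
      fix w assume w: "a + real 0 * d < w" "w < a + real (Suc 0) * d"
      have "\<bar>f w\<bar> \<le> B" using w ab dn[of 0] n by (intro f(2)) auto
      then show "- B \<le> f w" by linarith
    qed (use ab d in auto)
    then show ?thesis by simp
  qed
  \<comment> \<open>The last summand has no next cell, and \<open>J 0\<close> is left unmatched.
    Each costs at most \<open>B * d\<close>, which gives \<open>2 * B / n\<close> after division by
    \<open>b - a\<close>, the length of \<open>n\<close> cells.\<close>
  obtain m where m: "n = Suc m" using n gr0_conv_Suc by blast
  have "(\<Sum>j<n. d * F j) = (\<Sum>j<m. d * F j) + d * F m" unfolding m by simp
  also have "\<dots> \<le> (\<Sum>j<m. J (Suc j)) + d * B"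
    using FJ Fb[of m] d m by (intro add_mono sum_mono mult_left_mono) auto
  also have "(\<Sum>j<m. J (Suc j)) = (\<Sum>j<n. J j) - J 0" unfolding m by (simp add: sum.lessThan_Suc_shift del: sum.lessThan_Suc)
  also have "(\<Sum>j<n. J j) - J 0 + d * B \<le> (\<Sum>j<n. J j) + 2 * B * d" using J0 by (simp add: algebra_simps)
  finally have le: "d * (\<Sum>j<n. F j) \<le> (\<Sum>j<n. J j) + 2 * B * d" by (simp add: sum_distrib_left)
  have "(\<Sum>k<n. f (rot a b (real k * d) u)) = (\<Sum>k<n. F ((j0 + k) mod n))"
    using rotk by (intro sum.cong) auto
  also have "\<dots> = (\<Sum>k<n. F k)" using jn by (rule sum_mod_shift)
  finally have S: "(\<Sum>k<n. f (rot a b (real k * d) u)) = (\<Sum>k<n. F k)" .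
  have "(\<Sum>k<n. F k) / n = d * (\<Sum>k<n. F k) / (b - a)" using ab n by (simp add: d_def)
  also have "\<dots> \<le> ((\<Sum>j<n. J j) + 2 * B * d) / (b - a)" using le ab by (intro divide_right_mono) auto
  also have "\<dots> = (\<Sum>j<n. J j) / (b - a) + 2 * B / n"
    using ab n by (simp add: add_divide_distrib d_def)
  finally show ?thesis unfolding S[unfolded d_def] Jsum .
qed

text \<open>Nothing is asked of \<open>g\<close> at the point \<open>a\<close> itself, so
  \<open>g\<close> may be assembled from half-open cells. Since \<open>f\<close> need only be
  increasing inside the interval, the lemma applies to one cell after another.\<close>

lemma superlinear_average:
  fixes f g :: "real \<Rightarrow> real"
  assumes E: "superlinear_expectation unit_space E"
    and f: "f \<in> borel_measurable unit_space" "\<And>u. 0 < u \<Longrightarrow> u < 1 \<Longrightarrow> \<bar>f u\<bar> \<le> B"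
    and ab: "0 \<le> a" "a < b" "b \<le> 1" and mono: "\<And>u v. a < u \<Longrightarrow> u \<le> v \<Longrightarrow> v < b \<Longrightarrow> f u \<le> f v"
    and g: "g \<in> bounded_rvs unit_space" "\<And>u. 0 < u \<Longrightarrow> u < 1 \<Longrightarrow> u \<notin> {a..<b} \<Longrightarrow> g u = f u"
    and gm: "\<And>u. a < u \<Longrightarrow> u < b \<Longrightarrow> g u = (\<integral>u. f u * indicator {a..<b} u \<partial>unit_space) / (b - a)"
  shows "E f \<le> E g"
proof -
  have fb: "f \<in> bounded_rvs unit_space" using f by (rule bounded_rvs_unit)
  have B: "0 \<le> B" using f(2)[of "1/2"] by simp
  have *: "E f \<le> E g + 2 * B / n" if n: "n > 0" for n :: nat
  proof -
    define s where "s = (\<lambda>k::nat. real k * ((b - a) / n))"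
    have s: "0 \<le> s k" "s k \<le> b - a" if "k < n" for k
    proof -
      show "0 \<le> s k" using ab by (simp add: s_def)
      have "real k * (b - a) \<le> real n * (b - a)" using that ab by (intro mult_right_mono) auto
      then show "s k \<le> b - a" using n by (simp add: s_def field_simps)
    qed
    have r: "(\<lambda>u. f (rot a b (s k) u)) \<in> bounded_rvs unit_space"
      "E (\<lambda>u. f (rot a b (s k) u)) = E f" if "k < n" for k
    proof -
      note R = rot_unit_space[OF ab(1,3) s[OF that]]
      show 1: "(\<lambda>u. f (rot a b (s k) u)) \<in> bounded_rvs unit_space"
        using R fb by (rule bounded_rvs_transport)
      show "E (\<lambda>u. f (rot a b (s k) u)) = E f"
        using E 1 fb distr_transport[OF R f(1)] by (rule superlinear_law)
    qed
    define A where "A = (\<lambda>u. (1 / n) * (\<Sum>k<n. f (rot a b (s k) u)))"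
    have S: "(\<lambda>u. \<Sum>k<n. f (rot a b (s k) u)) \<in> bounded_rvs unit_space" using r by (intro bounded_rvs_sum)
    have "E f = (1 / n) * (\<Sum>k<n. E (\<lambda>u. f (rot a b (s k) u)))" using r n by simp
    also have "\<dots> \<le> (1 / n) * E (\<lambda>u. \<Sum>k<n. f (rot a b (s k) u))"
      using superlinear_sum[OF E r(1)] by (intro mult_left_mono) auto
    also have "\<dots> = E A" unfolding A_def using superlinear_scale[OF E S, of "1 / n"] by simp
    also have "E A \<le> E g + 2 * B / n"
    proof (rule superlinear_le_add_const[OF E _ g(1)])
      show "A \<in> bounded_rvs unit_space" unfolding A_def using S by (rule bounded_rvs_scale)
      have "AE u in unit_space. u \<in> {0<..<1}" using AE_space[of unit_space] by simp
      \<comment> \<open>At the cell boundaries \<open>rot_average_le\<close> says nothing; index 0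
        also discards the point \<open>a\<close>, where \<open>g\<close> is free.\<close>
      moreover have "AE u in unit_space. u \<notin> {b} \<union> (\<lambda>j. a + real j * ((b - a) / n)) ` {..n}"
        by (rule AE_unit_space_countable) auto
      ultimately show "AE u in unit_space. A u \<le> g u + 2 * B / n"
      proof eventually_elim
        case (elim u)
        show ?case
        proof (cases "a < u \<and> u < b")
          case True
          then show ?thesis
            unfolding gm[OF True[THEN conjunct1] True[THEN conjunct2]]
            using rot_average_le[OF f ab mono n, of u] elim(2) by (auto simp: A_def s_def)
        next
          case False
          then have "rot a b (s k) u = u" if "k < n" for k using s[OF that] by (auto simp: rot_def)
          then have "A u = f u" using n by (simp add: A_def)
          moreover have "u \<noteq> a" using elim(2) by (auto intro: image_eqI[of _ _ 0])
          then have "g u = f u" using False elim by (intro g(2)) auto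
          ultimately show ?thesis using B by simp
        qed
      qed
    qed
    finally show ?thesis .
  qed
  have "(\<lambda>n. E g + 2 * B / real (Suc n)) \<longlonglongrightarrow> E g + 0"
    by (intro tendsto_intros LIMSEQ_Suc lim_const_over_n)
  then show ?thesis using *[of "Suc n" for n] by (auto intro!: LIMSEQ_le_const)
qed

section \<open>Dominance on a partition of the unit interval\<close>

lemma AE_unit: "AE u in unit_space. 0 < u \<and> u < 1"
  using AE_space[of unit_space] by simp

locale unit_partition =
  fixes s :: "nat \<Rightarrow> real" and m :: nat
  assumes s_0: "s 0 = 0" and s_m: "s m = 1" and s_Suc: "i < m \<Longrightarrow> s i < s (Suc i)"
begin

lemma m_pos: "0 < m"
  using s_0 s_m by (cases m) auto

lemma s_le: "i \<le> j \<Longrightarrow> j \<le> m \<Longrightarrow> s i \<le> s j"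
proof (induction j rule: dec_induct)
  case (step j)
  then have "s i \<le> s j" "s j < s (Suc j)" using s_Suc[of j] by simp_all
  then show ?case by simp
qed simp

lemma s_nonneg: "i \<le> m \<Longrightarrow> 0 \<le> s i"
  using s_le[of 0 i] s_0 by simp

lemma s_le_1: "i \<le> m \<Longrightarrow> s i \<le> 1"
  using s_le[of i m] s_m by simp

lemma cell_exists:
  assumes "0 \<le> u" "u < 1"
  shows "\<exists>i<m. s i \<le> u \<and> u < s (Suc i)"
proof -
  define k where "k = (LEAST k. u < s k)"
  have k: "u < s k" unfolding k_def by (rule LeastI[of _ m]) (simp add: s_m assms)
  have km: "k \<le> m" unfolding k_def by (rule Least_le) (simp add: s_m assms)
  have "k \<noteq> 0" using k s_0 assms by (intro notI) simp
  then obtain i where i: "k = Suc i" using not0_implies_Suc by blast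
  have "\<not> u < s i" using not_less_Least[of i "\<lambda>k. u < s k"] i unfolding k_def by simp
  then show ?thesis using k km i by (intro exI[of _ i]) auto
qed

lemma cell_unique:
  assumes "i < m" "j < m" "s i \<le> u" "u < s (Suc i)" "s j \<le> u" "u < s (Suc j)"
  shows "i = j"
proof (rule ccontr)
  assume "i \<noteq> j"
  then consider "Suc i \<le> j" | "Suc j \<le> i" by linarith
  then show False
  proof cases
    case 1
    then show False using s_le[of "Suc i" j] assms by simp
  next
    case 2
    then show False using s_le[of "Suc j" i] assms by simp
  qed
qed

definition step :: "(nat \<Rightarrow> real) \<Rightarrow> real \<Rightarrow> real" where
  "step c u = (\<Sum>i<m. c i * indicator {s i..<s (Suc i)} u)"

lemma step_eq:
  assumes "i < m" "s i \<le> u" "u < s (Suc i)"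
  shows "step c u = c i"
proof -
  have "step c u = (\<Sum>j<m. if j = i then c i else 0)"
    unfolding step_def
  proof (intro sum.cong refl)
    fix j assume "j \<in> {..<m}"
    then have j: "j < m" by simp
    have "u \<in> {s j..<s (Suc j)} \<longleftrightarrow> j = i"
    proof
      assume "u \<in> {s j..<s (Suc j)}"
      then show "j = i" using j assms by (intro cell_unique[of j i u]) simp_all
    qed (use assms in simp)
    then show "c j * indicator {s j..<s (Suc j)} u = (if j = i then c i else 0)"
      by (simp only: indicator_def) simp
  qed
  then show ?thesis using assms by simp
qed

lemma step_cong: "(\<And>i. i < m \<Longrightarrow> c i = c' i) \<Longrightarrow> step c = step c'"
  unfolding step_def[abs_def] by (intro ext sum.cong) auto

lemma step_combination: "step (\<lambda>i. a * c i + b * c' i) = (\<lambda>u. a * step c u + b * step c' u)"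
  unfolding step_def[abs_def] sum_distrib_left sum.distrib[symmetric]
  by (intro ext sum.cong refl) (simp add: distrib_right mult.assoc)

lemma step_measurable [measurable]: "step c \<in> borel_measurable borel"
  unfolding step_def[abs_def] by measurable

lemma step_bounded: "\<bar>step c u\<bar> \<le> (\<Sum>i<m. \<bar>c i\<bar>)"
  unfolding step_def by (rule order_trans[OF sum_abs]) (intro sum_mono, auto simp: indicator_def)

lemma step_bounded_rvs: "step c \<in> bounded_rvs unit_space"
  by (rule bounded_rvsI[of _ _ "\<Sum>i<m. \<bar>c i\<bar>"]) (auto simp: step_bounded intro: measurable_unit_space)

lemma AE_cell: "AE u in unit_space. \<exists>i<m. s i < u \<and> u < s (Suc i)"
proof -
  have "AE u in unit_space. u \<notin> s ` {..m}" by (rule AE_unit_space_countable) auto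
  moreover note AE_unit
  ultimately show ?thesis
  proof eventually_elim
    case (elim u)
    obtain i where i: "i < m" "s i \<le> u" "u < s (Suc i)" using cell_exists[of u] elim by auto
    then have "s i \<noteq> u" using elim(1) by auto
    then show ?case using i by (intro exI[of _ i]) auto
  qed
qed

definition len :: "nat \<Rightarrow> real" where
  "len i = s (Suc i) - s i"

lemma len_pos: "i < m \<Longrightarrow> 0 < len i"
  unfolding len_def using s_Suc by simp

definition avg :: "(real \<Rightarrow> real) \<Rightarrow> nat \<Rightarrow> real" where
  "avg f i = (\<integral>u. f u * indicator {s i..<s (Suc i)} u \<partial>unit_space) / len i"

context
  fixes f :: "real \<Rightarrow> real" and B :: real
  assumes f: "f \<in> borel_measurable unit_space" "\<And>u. 0 < u \<Longrightarrow> u < 1 \<Longrightarrow> \<bar>f u\<bar> \<le> B"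
begin

lemma avg_ge:
  assumes "i < m" "\<And>u. s i < u \<Longrightarrow> u < s (Suc i) \<Longrightarrow> c \<le> f u"
  shows "c \<le> avg f i"
proof -
  have "c * (s (Suc i) - s i) \<le> (\<integral>u. f u * indicator {s i..<s (Suc i)} u \<partial>unit_space)"
    using assms s_Suc[of i] by (intro cell_integral_ge[OF f] s_nonneg s_le_1) auto
  then show ?thesis using len_pos[OF assms(1)] by (simp add: avg_def len_def le_divide_eq)
qed

lemma avg_le:
  assumes "i < m" "\<And>u. s i < u \<Longrightarrow> u < s (Suc i) \<Longrightarrow> f u \<le> c"
  shows "avg f i \<le> c"
proof -
  have "(\<integral>u. f u * indicator {s i..<s (Suc i)} u \<partial>unit_space) \<le> c * (s (Suc i) - s i)"
    using assms s_Suc[of i] by (intro cell_integral_le[OF f] s_nonneg s_le_1) auto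
  then show ?thesis using len_pos[OF assms(1)] by (simp add: avg_def len_def divide_le_eq)
qed

lemma sum_len_avg:
  assumes "k \<le> m"
  shows "(\<Sum>i<k. len i * avg f i) = (\<integral>u. f u * indicator {0..<s k} u \<partial>unit_space)"
proof -
  have "len i * avg f i = (\<integral>u. f u * indicator {s i..<s (Suc i)} u \<partial>unit_space)" if "i < m" for i
    using len_pos[OF that] unfolding avg_def by simp
  then have "(\<Sum>i<k. len i * avg f i) = (\<Sum>i<k. \<integral>u. f u * indicator {s i..<s (Suc i)} u \<partial>unit_space)"
    using assms by (intro sum.cong refl) simp
  also have "\<dots> = (\<integral>u. f u * indicator {s 0..<s k} u \<partial>unit_space)"
    using assms s_Suc by (intro integral_indicator_cells[OF f]) (auto intro: less_imp_le)
  finally show ?thesis by (simp add: s_0)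
qed

lemma superlinear_step_avg:
  assumes E: "superlinear_expectation unit_space E" and mono: "mono_on {0<..<1} f"
  shows "E f \<le> E (step (avg f))"
proof -
  \<comment> \<open>\<open>h j\<close> is already averaged on the first \<open>j\<close> cells and
    still equals \<open>f\<close> further right. Passing to \<open>h (Suc j)\<close> averages over
    one cell, and there \<open>h j\<close> inherits the monotonicity of \<open>f\<close>.\<close>
  define h where "h = (\<lambda>j u. if u < s j then step (avg f) u else f u)"
  define K where "K = max B (\<Sum>i<m. \<bar>avg f i\<bar>)"
  have hm: "h j \<in> borel_measurable unit_space" for j
  proof -
    have "(\<lambda>u. u < s j) \<in> measurable unit_space (count_space UNIV)"
      unfolding unit_space_def by (intro measurable_restrict_space1) measurable
    then show ?thesis unfolding h_def
      using f(1) measurable_unit_space[OF step_measurable] by (intro measurable_If) (auto simp: pred_def)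
  qed
  have hb: "\<bar>h j u\<bar> \<le> K" if "0 < u" "u < 1" for j u
    using f(2)[OF that] step_bounded[of "avg f" u] by (auto simp: h_def K_def)
  have hr: "h j \<in> bounded_rvs unit_space" for j using hm hb by (rule bounded_rvs_unit)
  have "E f \<le> E (h j)" if "j \<le> m" for j
    using that
  proof (induction j)
    case 0
    have "f \<in> bounded_rvs unit_space" using f by (rule bounded_rvs_unit)
    then show ?case
      by (intro superlinear_mono[OF E _ hr] eventually_mono[OF AE_unit]) (simp_all add: h_def s_0)
  next
    case (Suc j)
    have j: "j < m" using Suc.prems by simp
    have hf: "h j u = f u" if "s j \<le> u" for u using that by (simp add: h_def)
    have "E (h j) \<le> E (h (Suc j))"
    proof (rule superlinear_average[OF E hm hb _ s_Suc[OF j] _ _ hr])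
      show "0 \<le> s j" "s (Suc j) \<le> 1" using Suc.prems by (auto intro: s_nonneg s_le_1)
      fix u v assume "s j < u" "u \<le> v" "v < s (Suc j)"
      then show "h j u \<le> h j v"
        using s_nonneg[of j] s_le_1[of "Suc j"] j by (auto simp: hf intro!: mono_onD[OF mono])
    next
      fix u assume u: "u \<notin> {s j..<s (Suc j)}"
      show "h (Suc j) u = h j u" using u s_Suc[OF j] by (auto simp: h_def)
    next
      fix u assume u: "s j < u" "u < s (Suc j)"
      have "h (Suc j) u = avg f j" using u step_eq[OF j, of u] by (simp add: h_def)
      also have "\<dots> = (\<integral>u. h j u * indicator {s j..<s (Suc j)} u \<partial>unit_space) / (s (Suc j) - s j)"
        unfolding avg_def len_def
        by (intro arg_cong2[where f="(/)"] Bochner_Integration.integral_cong refl) (auto simp: hf indicator_def)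
      finally show "h (Suc j) u = (\<integral>u. h j u * indicator {s j..<s (Suc j)} u \<partial>unit_space) / (s (Suc j) - s j)" .
    qed
    then show ?case using Suc by simp
  qed
  then have "E f \<le> E (h m)" by simp
  also have "\<dots> \<le> E (step (avg f))"
    by (intro superlinear_mono[OF E hr step_bounded_rvs] eventually_mono[OF AE_unit]) (simp add: h_def s_m)
  finally show ?thesis .
qed

end

lemma superlinear_step_mono:
  assumes E: "superlinear_expectation unit_space E" and "\<And>i. i < m \<Longrightarrow> c i \<le> c' i"
  shows "E (step c) \<le> E (step c')"
  using AE_cell
  by (intro superlinear_mono[OF E step_bounded_rvs step_bounded_rvs])
    (auto elim!: eventually_mono simp: step_eq assms(2))

text \<open>A transfer of mass \<open>d\<close> between adjacent cells is a convex combination of doing nothing and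
  of averaging over the union of the two cells.\<close>

lemma superlinear_step_transfer:
  assumes E: "superlinear_expectation unit_space E" and j: "Suc j < m" and d: "0 \<le> d"
    and gap: "c j + d / len j \<le> c (Suc j) - d / len (Suc j)"
  shows "E (step c) \<le> E (step (c(j := c j + d / len j, Suc j := c (Suc j) - d / len (Suc j))))"
proof -
  define l1 where "l1 = len j"
  define l2 where "l2 = len (Suc j)"
  have l: "0 < l1" "0 < l2" using len_pos j by (simp_all add: l1_def l2_def)
  have g0: "c j + d / l1 \<le> c (Suc j) - d / l2" using gap by (simp add: l1_def l2_def)
  have d1: "0 \<le> d / l1" "0 \<le> d / l2" using d l by simp_all
  \<comment> \<open>The length-weighted mean over the two cells; \<open>c2\<close> is the result of
    averaging over their union.\<close>
  define \<mu> where "\<mu> = (c j * l1 + c (Suc j) * l2) / (l1 + l2)"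
  define c2 where "c2 = c(j := \<mu>, Suc j := \<mu>)"
  have cj: "c j \<le> c (Suc j)" using g0 d1 by linarith
  have s2: "s j < s (Suc j)" "s (Suc j) < s (Suc (Suc j))" using s_Suc j by simp_all
  have "E (step c) \<le> E (step c2)"
  proof (rule superlinear_average[OF E measurable_unit_space[OF step_measurable] step_bounded _ _ _ _ step_bounded_rvs, of "s j" "s (Suc (Suc j))"])
    show "0 \<le> s j" "s (Suc (Suc j)) \<le> 1" using j by (auto intro: s_nonneg s_le_1)
    show "s j < s (Suc (Suc j))" using s2 by simp
  next
    fix u v assume "s j < u" "u \<le> v" "v < s (Suc (Suc j))"
    then consider "u < s (Suc j)" "v < s (Suc j)" "s j \<le> u" "s j \<le> v"
      | "u < s (Suc j)" "s (Suc j) \<le> v" "s j \<le> u" "v < s (Suc (Suc j))"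
      | "s (Suc j) \<le> u" "s (Suc j) \<le> v" "u < s (Suc (Suc j))" "v < s (Suc (Suc j))" by linarith
    then show "step c u \<le> step c v"
      using cj j step_eq[of j u c] step_eq[of j v c] step_eq[of "Suc j" u c] step_eq[of "Suc j" v c]
      by cases simp_all
  next
    fix u assume u: "0 < u" "u < 1" "u \<notin> {s j..<s (Suc (Suc j))}"
    obtain i where i: "i < m" "s i \<le> u" "u < s (Suc i)" using cell_exists[of u] u by auto
    then have "i \<noteq> j" "i \<noteq> Suc j" using u(3) s2 by auto
    then show "step c2 u = step c u" using step_eq[OF i] by (simp add: c2_def)
  next
    fix u assume u: "s j < u" "u < s (Suc (Suc j))"
    have "step c2 u = \<mu>"
    proof (cases "u < s (Suc j)")
      case True
      then show ?thesis using step_eq[of j u c2] u j by (simp add: c2_def)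
    next
      case False
      then show ?thesis using step_eq[of "Suc j" u c2] u j by (simp add: c2_def)
    qed
    have "(\<integral>u. step c u * indicator {s j..<s (Suc (Suc j))} u \<partial>unit_space) =
      (\<integral>u. c j * indicator {s j..<s (Suc j)} u + c (Suc j) * indicator {s (Suc j)..<s (Suc (Suc j))} u \<partial>unit_space)"
    proof (intro Bochner_Integration.integral_cong refl)
      fix u
      consider "u < s j" | "s j \<le> u" "u < s (Suc j)" | "s (Suc j) \<le> u" "u < s (Suc (Suc j))"
        | "s (Suc (Suc j)) \<le> u" by linarith
      then show "step c u * indicator {s j..<s (Suc (Suc j))} u =
          c j * indicator {s j..<s (Suc j)} u + c (Suc j) * indicator {s (Suc j)..<s (Suc (Suc j))} u"
        using s2 j step_eq[of j u c] step_eq[of "Suc j" u c] by cases (simp_all add: indicator_def)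
    qed
    also have "\<dots> = (\<integral>u. c j * indicator {s j..<s (Suc j)} u \<partial>unit_space) +
        (\<integral>u. c (Suc j) * indicator {s (Suc j)..<s (Suc (Suc j))} u \<partial>unit_space)"
      by (intro Bochner_Integration.integral_add integrable_unit_indicator[of "\<lambda>_. c j" "\<bar>c j\<bar>"]
          integrable_unit_indicator[of "\<lambda>_. c (Suc j)" "\<bar>c (Suc j)\<bar>"]) auto
    also have "(\<integral>u. c j * indicator {s j..<s (Suc j)} u \<partial>unit_space) = c j * l1"
      unfolding l1_def len_def using s2 j by (intro integral_unit_indicator s_nonneg s_le_1) auto
    also have "(\<integral>u. c (Suc j) * indicator {s (Suc j)..<s (Suc (Suc j))} u \<partial>unit_space) = c (Suc j) * l2"
      unfolding l2_def len_def using s2 j by (intro integral_unit_indicator s_nonneg s_le_1) auto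
    finally have "(\<integral>u. step c u * indicator {s j..<s (Suc (Suc j))} u \<partial>unit_space) = c j * l1 + c (Suc j) * l2" .
    moreover have "s (Suc (Suc j)) - s j = l1 + l2" by (simp add: l1_def l2_def len_def)
    ultimately show "step c2 u = (\<integral>u. step c u * indicator {s j..<s (Suc (Suc j))} u \<partial>unit_space) / (s (Suc (Suc j)) - s j)"
      using \<open>step c2 u = \<mu>\<close> by (simp add: \<mu>_def)
  qed
  then have c2: "E (step c) \<le> E (step c2)" .
  define g where "g = c (Suc j) - c j"
  \<comment> \<open>The solution of \<open>t * (\<mu> - c j) = d / l1\<close>, which also solves the
    equation for the right cell because both sides conserve mass. The gap condition is what gives
    \<open>t \<le> 1\<close>; if \<open>g = 0\<close>, it forces \<open>d = 0\<close> and there is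
    nothing to move.\<close>
  define t where "t = (if g = 0 then 0 else d * (l1 + l2) / (l1 * l2 * g))"
  have g: "d / l1 + d / l2 \<le> g" using g0 by (simp add: g_def)
  then have gn: "0 \<le> g" using d1 by linarith
  have g': "d * (l1 + l2) \<le> l1 * l2 * g"
  proof -
    have "d * (l1 + l2) = l1 * l2 * (d / l1 + d / l2)" using l by (simp add: field_simps)
    also have "\<dots> \<le> l1 * l2 * g" using g l by (intro mult_left_mono) auto
    finally show ?thesis .
  qed
  have t: "0 \<le> t" "t \<le> 1" using gn g' l d by (auto simp: t_def divide_le_eq)
  have dz: "d = 0" if "g = 0"
  proof -
    have "d * (l1 + l2) \<le> 0" using g' that by simp
    then show ?thesis using d l by (simp add: mult_le_0_iff)
  qed
  have \<mu>1: "\<mu> - c j = l2 * g / (l1 + l2)" "c (Suc j) - \<mu> = l1 * g / (l1 + l2)"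
    using l by (simp_all add: \<mu>_def g_def field_simps)
  have aux: "d * L / (l1 * l2 * g) * (l2 * g / L) = d / l1" "d * L / (l1 * l2 * g) * (l1 * g / L) = d / l2"
    if "g \<noteq> 0" "L \<noteq> 0" for L
    using l that by (simp_all add: field_simps)
  have l12: "l1 + l2 \<noteq> 0" using l by simp
  have "t * (l2 * g / (l1 + l2)) = d / l1"
    using aux(1)[OF _ l12] dz by (cases "g = 0") (simp_all add: t_def)
  then have t1: "(1 - t) * c j + t * \<mu> = c j + d / l1"
    unfolding \<mu>1(1)[symmetric] by (simp add: algebra_simps)
  have "t * (l1 * g / (l1 + l2)) = d / l2"
    using aux(2)[OF _ l12] dz by (cases "g = 0") (simp_all add: t_def)
  then have t2: "(1 - t) * c (Suc j) + t * \<mu> = c (Suc j) - d / l2"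
    unfolding \<mu>1(2)[symmetric] by (simp add: algebra_simps)
  define c1 where "c1 = c(j := c j + d / l1, Suc j := c (Suc j) - d / l2)"
  have c1: "c1 i = (1 - t) * c i + t * c2 i" for i
    using t1 t2 by (simp add: c1_def c2_def algebra_simps)
  have "step c1 = (\<lambda>u. (1 - t) * step c u + t * step c2 u)"
    unfolding step_combination[symmetric] using c1 by (rule step_cong)
  moreover have "E (step c) \<le> E (\<lambda>u. (1 - t) * step c u + t * step c2 u)"
    using t c2 by (intro superlinear_convex_le[OF E step_bounded_rvs step_bounded_rvs]) auto
  ultimately show ?thesis by (simp add: c1_def l1_def l2_def)
qed

text \<open>By concavity it suffices to compare \<open>Y\<close> with
  \<open>Y - t d\<close> for a small \<open>t > 0\<close>; then the steps stay increasing while the partial sums are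
  transferred from left to right.\<close>

lemma superlinear_step_dominance:
  fixes Y d :: "nat \<Rightarrow> real"
  assumes E: "superlinear_expectation unit_space E" and e: "0 < e"
    and Y: "\<And>i. Suc i < m \<Longrightarrow> Y i + e \<le> Y (Suc i)"
    and d: "\<And>k. k < m \<Longrightarrow> 0 \<le> (\<Sum>i\<le>k. len i * d i)"
  shows "E (step (\<lambda>i. Y i - d i)) \<le> E (step Y)"
proof -
  define D where "D = (\<lambda>k. \<Sum>i\<le>k. len i * d i)"
  define B where "B = (\<Sum>i<m. \<bar>d i\<bar> + \<bar>D i / len i\<bar>)"
  have B: "\<bar>d i\<bar> + \<bar>D i / len i\<bar> \<le> B" if "i < m" for i
    unfolding B_def using that by (intro member_le_sum) auto
  have B0: "0 \<le> B" unfolding B_def by (intro sum_nonneg) auto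
  \<comment> \<open>Chosen so that \<open>t * B \<le> e\<close>: no partial deficit, scaled by
    \<open>t\<close>, uses up the gap \<open>e\<close> between neighbouring values of
    \<open>Y\<close>. The 1 in \<open>B + 1\<close> avoids division by 0.\<close>
  define t where "t = min 1 (e / (B + 1))"
  have t: "0 < t" "t \<le> 1" using e B0 by (auto simp: t_def)
  have "t * B \<le> e / (B + 1) * B" using B0 by (intro mult_right_mono) (auto simp: t_def)
  also have "\<dots> \<le> e" using e B0 by (simp add: divide_le_eq)
  finally have tB: "t * B \<le> e" .
  \<comment> \<open>The state after \<open>j\<close> transfers. Cells before \<open>j\<close> have
    reached \<open>Y\<close>, cell \<open>j\<close> carries the whole deficit accumulated so far,
    and the later cells still have the value \<open>Y i - t * d i\<close>. The deficit left at the
    end is nonnegative and is simply dropped.\<close>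
  define c where "c = (\<lambda>j i. Y i - t * (if i < j then 0 else if i = j then D i / len i else d i))"
  have D0: "D 0 = len 0 * d 0" by (simp add: D_def)
  have DS: "D (Suc j) = D j + len (Suc j) * d (Suc j)" for j by (simp add: D_def)
  have Dp: "0 \<le> D j" if "j < m" for j using d[OF that] by (simp add: D_def)
  have "E (step (c 0)) \<le> E (step (c j))" if "j < m" for j
    using that
  proof (induction j)
    case (Suc j)
    have l: "0 < len j" "0 < len (Suc j)" using len_pos Suc.prems by simp_all
    have eq: "(c j)(j := c j j + t * D j / len j, Suc j := c j (Suc j) - t * D j / len (Suc j)) = c (Suc j)"
      (is "?L = _")
    proof
      fix i
      consider "i < j" | "i = j" | "i = Suc j" | "Suc j < i" by linarith
      then show "?L i = c (Suc j) i"
        using l by cases (simp_all add: c_def DS add_divide_distrib algebra_simps)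
    qed
    have "D (Suc j) / len (Suc j) \<le> B" using B[OF Suc.prems] by linarith
    then have "t * (D (Suc j) / len (Suc j)) \<le> t * B"
      using t by (intro mult_left_mono) auto
    \<comment> \<open>The values after the transfer are those of \<open>c (Suc j)\<close>, so the
      condition for a transfer says that this state is still increasing from \<open>j\<close> to
      \<open>Suc j\<close>.\<close>
    then have gap: "c (Suc j) j \<le> c (Suc j) (Suc j)"
      using Y[OF Suc.prems] tB by (simp add: c_def)
    have "E (step (c j)) \<le> E (step ((c j)(j := c j j + t * D j / len j, Suc j := c j (Suc j) - t * D j / len (Suc j))))"
    proof (rule superlinear_step_transfer[OF E Suc.prems])
      show "0 \<le> t * D j" using t Dp[of j] Suc.prems by simp
      show "c j j + t * D j / len j \<le> c j (Suc j) - t * D j / len (Suc j)"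
        using gap unfolding eq[symmetric] by simp
    qed
    then show ?case using Suc unfolding eq by simp
  qed simp
  then have "E (step (c 0)) \<le> E (step (c (m - 1)))" using m_pos by simp
  also have "\<dots> \<le> E (step Y)"
  proof (rule superlinear_step_mono[OF E])
    fix i assume i: "i < m"
    have "0 \<le> t * (D i / len i)" using Dp[OF i] len_pos[OF i] t by simp
    moreover have "i < m - 1 \<or> i = m - 1" using i by linarith
    ultimately show "c (m - 1) i \<le> Y i" unfolding c_def by auto
  qed
  finally have c0: "E (step (c 0)) \<le> E (step Y)" .
  have "(1 - t) * E (step Y) + t * E (step (\<lambda>i. Y i - d i)) \<le>
      E (\<lambda>u. (1 - t) * step Y u + t * step (\<lambda>i. Y i - d i) u)"
    using t by (intro superlinear_convex[OF E step_bounded_rvs step_bounded_rvs]) auto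
  also have "(\<lambda>u. (1 - t) * step Y u + t * step (\<lambda>i. Y i - d i) u) = step (c 0)"
  proof -
    have "(1 - t) * Y i + t * (Y i - d i) = c 0 i" if "i < m" for i
      using D0 len_pos[OF m_pos] by (cases "i = 0") (simp_all add: c_def algebra_simps)
    then show ?thesis unfolding step_combination[symmetric] by (rule step_cong)
  qed
  finally have "t * E (step (\<lambda>i. Y i - d i)) \<le> t * E (step Y)" using c0 by (simp add: algebra_simps)
  then show ?thesis using t by simp
qed

end

section \<open>Partitions adapted to an increasing function\<close>

lemma unit_partition_of_finite:
  assumes "finite S" "0 \<in> S" "1 \<in> S" "S \<subseteq> {0..1::real}"
  shows "\<exists>s m. unit_partition s m \<and> (\<forall>x\<in>S. \<forall>i<m. \<not> (s i < x \<and> x < s (Suc i)))"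
proof -
  define l where "l = sorted_list_of_set S"
  have l: "sorted l" "distinct l" "set l = S" using assms(1) by (simp_all add: l_def)
  have ne: "l \<noteq> []" using l(3) assms(2) by auto
  define m where "m = length l - 1"
  have lm: "length l = Suc m" using ne by (simp add: m_def)
  have mono: "l ! i \<le> l ! j" if "i \<le> j" "j \<le> m" for i j
    using sorted_nth_mono[OF l(1)] that lm by simp
  have mem: "l ! i \<in> S" if "i \<le> m" for i using that lm l(3) nth_mem[of i l] by simp
  have ex: "\<exists>k\<le>m. l ! k = x" if "x \<in> S" for x
    using that unfolding l(3)[symmetric] in_set_conv_nth lm less_Suc_eq_le by blast
  have "unit_partition (\<lambda>i. l ! i) m"
  proof
    obtain k where k: "k \<le> m" "l ! k = 0" using ex[OF assms(2)] by blast
    have "0 \<le> l ! 0" using mem[of 0] assms(4) by auto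
    then show "l ! 0 = 0" using mono[of 0 k] k by simp
    obtain k where k: "k \<le> m" "l ! k = 1" using ex[OF assms(3)] by blast
    have "l ! m \<le> 1" using mem[of m] assms(4) by auto
    then show "l ! m = 1" using mono[of k m] k by simp
    fix i assume i: "i < m"
    have "l ! i \<noteq> l ! Suc i" using nth_eq_iff_index_eq[OF l(2), of i "Suc i"] i lm by simp
    then show "l ! i < l ! Suc i" using mono[of i "Suc i"] i by simp
  qed
  moreover have "\<not> (l ! i < x \<and> x < l ! Suc i)" if x: "x \<in> S" and i: "i < m" for x i
  proof -
    obtain k where k: "k \<le> m" "l ! k = x" using ex[OF x] by blast
    show ?thesis using mono[of k i] mono[of "Suc i" k] k i by (cases "k \<le> i") auto
  qed
  ultimately show ?thesis by blast
qed

text \<open>A jump of \<open>q\<close> may lie anywhere, so equal cells would not do. The unit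
  interval is cut where \<open>q\<close> crosses the levels \<open>k * e\<close>; since
  \<open>q\<close> is bounded, finitely many levels suffice.\<close>

lemma unit_partition_small_oscillation:
  assumes mono: "mono_on {0<..<1} q" and B: "\<And>u. 0 < u \<Longrightarrow> u < 1 \<Longrightarrow> \<bar>q u\<bar> \<le> B" and e: "(0::real) < e"
  shows "\<exists>s m. unit_partition s m \<and>
    (\<forall>i<m. \<forall>u v. s i < u \<longrightarrow> u < s (Suc i) \<longrightarrow> s i < v \<longrightarrow> v < s (Suc i) \<longrightarrow> q v \<le> q u + e)"
proof -
  \<comment> \<open>\<open>p k\<close>, the supremum of this set, is the crossing point of the level
    \<open>k * e\<close>. The added 0 keeps the set nonempty, so that a level below all values of
    \<open>q\<close> gets 0.\<close>
  define A where "A = (\<lambda>k::int. insert 0 {u. 0 < u \<and> u < 1 \<and> q u \<le> k * e})"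
  define p where "p = (\<lambda>k. Sup (A k))"
  define N where "N = \<lceil>B / e\<rceil>"
  have bdd: "bdd_above (A k)" for k unfolding A_def by (intro bdd_aboveI[of _ 1]) auto
  have up: "u \<le> p k" if "u \<in> A k" for u k unfolding p_def using that bdd by (rule cSup_upper)
  have le: "p k \<le> v" if "\<And>u. u \<in> A k \<Longrightarrow> u \<le> v" for k v
    unfolding p_def using that by (intro cSup_least) (auto simp: A_def)
  have p01: "p k \<in> {0..1}" for k 
  proof -
    have "0 \<le> p k" by (rule up) (simp add: A_def)
    moreover have "p k \<le> 1" by (rule le) (auto simp: A_def)
    ultimately show ?thesis by simp
  qed
  define S where "S = insert 0 (insert 1 (p ` {-N..N}))"
  have "S \<subseteq> {0..1}" using p01 by (auto simp: S_def)
  then obtain s m where sm: "unit_partition s m" "\<forall>x\<in>S. \<forall>i<m. \<not> (s i < x \<and> x < s (Suc i))"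
    using unit_partition_of_finite[of S] by (auto simp: S_def)
  interpret unit_partition s m by (rule sm(1))
  have "q v \<le> q u + e" if i: "i < m" "s i < u" "u < s (Suc i)" "s i < v" "v < s (Suc i)" for i u v
  proof (rule ccontr)
    assume n: "\<not> q v \<le> q u + e"
    have uv: "0 < u" "u < 1" "0 < v" "v < 1"
      using i s_nonneg[of i] s_le_1[of "Suc i"] by simp_all
    \<comment> \<open>The lowest level that is not below \<open>q u\<close>. An increase of more
      than \<open>e\<close> from \<open>u\<close> to \<open>v\<close> passes this level, so its
      crossing point would lie strictly inside the cell.\<close>
    define k where "k = \<lceil>q u / e\<rceil>"
    have k: "q u / e \<le> k" "k < q u / e + 1" unfolding k_def by linarith+
    then have k': "q u \<le> k * e" "k * e < q u + e" using e by (simp_all add: field_simps)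
    have "u \<in> A k" using uv k' by (simp add: A_def)
    then have "u \<le> p k" by (rule up)
    moreover have "p k \<le> v"
    proof (rule le)
      fix w assume w: "w \<in> A k"
      show "w \<le> v"
      proof (rule ccontr)
        assume "\<not> w \<le> v"
        then have "w \<noteq> 0" "v \<le> w" using uv by auto
        then have "0 < w" "w < 1" "q w \<le> k * e" using w by (auto simp: A_def)
        moreover have "q v \<le> q w" using \<open>v \<le> w\<close> uv calculation by (intro mono_onD[OF mono]) auto
        ultimately show False using n k' by linarith
      qed
    qed
    ultimately have "s i < p k" "p k < s (Suc i)" using i by simp_all
    moreover have "k \<in> {-N..N}"
    proof -
      have "\<bar>q u\<bar> \<le> B" using uv by (intro B)
      then have "\<bar>q u / e\<bar> \<le> B / e" using e by (simp add: abs_divide divide_right_mono)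
      then have "q u / e \<le> B / e" "- (B / e) \<le> q u / e" by linarith+
      then show ?thesis unfolding k_def N_def by (simp add: ceiling_mono) linarith
    qed
    then have "p k \<in> S" by (simp add: S_def)
    ultimately show False using sm(2) i(1) by blast
  qed
  then show ?thesis using sm(1) by blast
qed

text \<open>For every \<open>t\<close>, \<open>t * indicator {0..<r} u - max 0 (t - f u) \<le> f u *
  indicator {0..<r} u\<close>. For the increasing function \<open>q\<close> and \<open>t\<close> its
  value at \<open>r\<close> this is an equality, so the comparison at that single \<open>t\<close>
  suffices.\<close>

lemma quantile_dominance:
  fixes q q' :: "real \<Rightarrow> real"
  assumes q: "mono_on {0<..<1} q" "q \<in> borel_measurable unit_space" "\<And>u. 0 < u \<Longrightarrow> u < 1 \<Longrightarrow> \<bar>q u\<bar> \<le> B"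
    and q': "q' \<in> borel_measurable unit_space" "\<And>u. 0 < u \<Longrightarrow> u < 1 \<Longrightarrow> \<bar>q' u\<bar> \<le> B"
    and dom: "\<And>t. (\<integral>u. max 0 (t - q' u) \<partial>unit_space) \<le> (\<integral>u. max 0 (t - q u) \<partial>unit_space)"
    and r: "0 < r" "r \<le> 1"
  shows "(\<integral>u. q u * indicator {0..<r} u \<partial>unit_space) \<le> (\<integral>u. q' u * indicator {0..<r} u \<partial>unit_space)"
proof -
  \<comment> \<open>For \<open>r = 1\<close> the value of \<open>q\<close> at \<open>r\<close> means
    nothing; the upper bound \<open>B\<close> takes its place.\<close>
  define t where "t = (if r < 1 then q r else B)"
  have t1: "q u \<le> t" if "0 < u" "u < 1" "u < r" for u
    using that r q(3)[of u] by (auto simp: t_def intro!: mono_onD[OF q(1)])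
  have t2: "t \<le> q u" if "0 < u" "u < 1" "r \<le> u" for u
    using that r by (auto simp: t_def intro!: mono_onD[OF q(1)])
  have i: "integrable unit_space (\<lambda>u. max 0 (t - f u))" "integrable unit_space (\<lambda>u. f u * indicator {0..<r} u)"
      "integrable unit_space (\<lambda>u. t * indicator {0..<r} u)"
    if f: "f \<in> borel_measurable unit_space" "\<And>u. 0 < u \<Longrightarrow> u < 1 \<Longrightarrow> \<bar>f u\<bar> \<le> B" for f
  proof -
    show "integrable unit_space (\<lambda>u. max 0 (t - f u))"
    proof (rule integrable_unit)
      show "(\<lambda>u. max 0 (t - f u)) \<in> borel_measurable unit_space" using f(1) by measurable
      fix u :: real assume "0 < u" "u < 1"
      then show "\<bar>max 0 (t - f u)\<bar> \<le> \<bar>t\<bar> + B" using f(2)[of u] by (simp add: max_def) linarith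
    qed
    show "integrable unit_space (\<lambda>u. f u * indicator {0..<r} u)"
      using f by (rule integrable_unit_indicator) auto
    show "integrable unit_space (\<lambda>u. t * indicator {0..<r} u)"
      by (rule integrable_unit_indicator[of _ "\<bar>t\<bar>"]) auto
  qed
  have "(\<integral>u. q u * indicator {0..<r} u \<partial>unit_space) =
      (\<integral>u. t * indicator {0..<r} u - max 0 (t - q u) \<partial>unit_space)"
    using t1 t2 by (intro Bochner_Integration.integral_cong refl) (force simp: indicator_def max_def)
  also have "\<dots> = (\<integral>u. t * indicator {0..<r} u \<partial>unit_space) - (\<integral>u. max 0 (t - q u) \<partial>unit_space)"
    using i[OF q(2,3)] by (intro Bochner_Integration.integral_diff)
  also have "\<dots> \<le> (\<integral>u. t * indicator {0..<r} u \<partial>unit_space) - (\<integral>u. max 0 (t - q' u) \<partial>unit_space)"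
    using dom by simp
  also have "\<dots> = (\<integral>u. t * indicator {0..<r} u - max 0 (t - q' u) \<partial>unit_space)"
    using i[OF q'] by (intro Bochner_Integration.integral_diff[symmetric])
  also have "\<dots> \<le> (\<integral>u. q' u * indicator {0..<r} u \<partial>unit_space)"
    using i[OF q'] by (intro integral_mono Bochner_Integration.integrable_diff) (auto simp: indicator_def max_def)
  finally show ?thesis .
qed

text \<open>Here \<open>dom\<close> is dominance in the increasing concave order.\<close>

lemma superlinear_icv_mono_unit:
  fixes q q' :: "real \<Rightarrow> real"
  assumes E: "superlinear_expectation unit_space E"
    and q: "mono_on {0<..<1} q" "q \<in> borel_measurable unit_space" "\<And>u. 0 < u \<Longrightarrow> u < 1 \<Longrightarrow> \<bar>q u\<bar> \<le> B"
    and q': "mono_on {0<..<1} q'" "q' \<in> borel_measurable unit_space" "\<And>u. 0 < u \<Longrightarrow> u < 1 \<Longrightarrow> \<bar>q' u\<bar> \<le> B"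
    and dom: "\<And>t. (\<integral>u. max 0 (t - q' u) \<partial>unit_space) \<le> (\<integral>u. max 0 (t - q u) \<partial>unit_space)"
  shows "E q \<le> E q'"
proof (rule field_le_epsilon)
  fix e0 :: real assume "0 < e0"
  \<comment> \<open>One half pays for the oscillation of \<open>q'\<close> on a cell, the other for
    the slope that is added in \<open>Y\<close>.\<close>
  define e where "e = e0 / 2"
  have e: "0 < e" using \<open>0 < e0\<close> by (simp add: e_def)
  obtain s m where sm: "unit_partition s m" and osc:
    "\<forall>i<m. \<forall>u v. s i < u \<longrightarrow> u < s (Suc i) \<longrightarrow> s i < v \<longrightarrow> v < s (Suc i) \<longrightarrow> q' v \<le> q' u + e"
    using unit_partition_small_oscillation[OF q'(1,3) e] by blast
  interpret unit_partition s m by (rule sm)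
  \<comment> \<open>Neighbouring cell means of \<open>q'\<close> may coincide; the slope separates
    them by \<open>e / m\<close> and raises none by more than \<open>e\<close>.\<close>
  define Y where "Y = (\<lambda>i. avg q' i + e * (real i / m))"
  define d where "d = (\<lambda>i. avg q' i - avg q i)"
  have "E q \<le> E (step (avg q))" using q(2,3) E q(1) by (rule superlinear_step_avg)
  also have "\<dots> \<le> E (step (\<lambda>i. Y i - d i))"
    using e by (intro superlinear_step_mono[OF E]) (simp add: Y_def d_def)
  also have "\<dots> \<le> E (step Y)"
  proof (rule superlinear_step_dominance[OF E])
    show "0 < e / m" using e m_pos by simp
    fix i assume i: "Suc i < m"
    define x where "x = s (Suc i)"
    have x: "0 < x" "x < 1"
      using s_nonneg[of i] s_Suc[of i] s_Suc[of "Suc i"] s_le_1[of "Suc (Suc i)"] i by (simp_all add: x_def)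
    have "avg q' i \<le> q' x"
      using i x s_nonneg[of i] by (intro avg_le[OF q'(2,3)] mono_onD[OF q'(1)]) (auto simp: x_def)
    also have "\<dots> \<le> avg q' (Suc i)"
      using i x s_le_1[of "Suc (Suc i)"] by (intro avg_ge[OF q'(2,3)] mono_onD[OF q'(1)]) (auto simp: x_def)
    finally show "Y i + e / m \<le> Y (Suc i)"
      using m_pos by (simp add: Y_def add_divide_distrib algebra_simps)
  next
    fix k assume k: "k < m"
    have "(\<Sum>i\<le>k. len i * d i) = (\<Sum>i<Suc k. len i * avg q' i) - (\<Sum>i<Suc k. len i * avg q i)"
      unfolding lessThan_Suc_atMost by (simp add: d_def right_diff_distrib sum_subtractf)
    also have "\<dots> \<ge> 0"
    proof -
      have "0 < s (Suc k)" using s_nonneg[of k] s_Suc[of k] k by simp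
      then show ?thesis
        using k sum_len_avg[OF q(2,3), of "Suc k"] sum_len_avg[OF q'(2,3), of "Suc k"]
          quantile_dominance[OF q q'(2,3) dom, of "s (Suc k)"] s_le_1[of "Suc k"] by simp
    qed
    finally show "0 \<le> (\<Sum>i\<le>k. len i * d i)" .
  qed
  also have "\<dots> \<le> E q' + e0"
  proof (rule superlinear_le_add_const[OF E step_bounded_rvs])
    show "q' \<in> bounded_rvs unit_space" using q'(2,3) by (rule bounded_rvs_unit)
    show "AE u in unit_space. step Y u \<le> q' u + e0"
      using AE_cell
    proof eventually_elim
      case (elim u)
      then obtain i where i: "i < m" "s i < u" "u < s (Suc i)" by blast
      have "avg q' i \<le> q' u + e" using i osc by (intro avg_le[OF q'(2,3)]) auto
      moreover have "e * (real i / m) \<le> e * 1" using i e by (intro mult_left_mono) auto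
      moreover have "step Y u = Y i" using i by (intro step_eq) auto
      ultimately show ?case by (simp add: Y_def e_def)
    qed
  qed
  finally show "E q \<le> E q' + e0" .
qed

section \<open>Supermodular functions and comonotone couplings\<close>

context prob_space begin

text \<open>The quantile function is the pseudoinverse of the distribution function. The equivalence
  in the last clause will turn a formula for the joint distribution function into a joint law of
  quantile functions; the bound holds at every point, not only almost everywhere.\<close>

lemma quantile_exists:
  fixes X :: "'a \<Rightarrow> real"
  assumes X: "X \<in> borel_measurable M" and K: "AE w in M. \<bar>X w\<bar> \<le> K"
  shows "\<exists>q. mono_on {0<..<1} q \<and> q \<in> borel_measurable unit_space \<and>
    distr unit_space borel q = distr M borel X \<and> (\<forall>u. 0 < u \<longrightarrow> u < 1 \<longrightarrow> \<bar>q u\<bar> \<le> K) \<and>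
    (\<forall>u x. 0 < u \<longrightarrow> u < 1 \<longrightarrow> (u \<le> measure M {w \<in> space M. X w \<le> x} \<longleftrightarrow> q u \<le> x))"
proof -
  interpret D: cdf_distribution "distr M borel X"
    unfolding cdf_distribution_def using X by (rule real_distribution_distr)
  have C: "cdf (distr M borel X) x = measure M {w \<in> space M. X w \<le> x}" for x
    using X by (simp add: cdf_def measure_distr vimage_def Int_def conj_commute)
  have iff: "u \<le> measure M {w \<in> space M. X w \<le> x} \<longleftrightarrow> D.I u \<le> x" if "0 < u" "u < 1" for u x
    using D.pseudoinverse[OF that, of x] unfolding C .
  have b: "\<bar>D.I u\<bar> \<le> K" if u: "0 < u" "u < 1" for u
  proof -
    have "measure M {w \<in> space M. X w \<le> K} = 1"
      using K X by (subst prob_Collect_eq_1) (auto elim!: eventually_mono)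
    then have "D.I u \<le> K" using iff[OF u, of K] u by simp
    moreover have "- K \<le> D.I u"
    proof (rule ccontr)
      assume n: "\<not> - K \<le> D.I u"
      have "measure M {w \<in> space M. X w \<le> D.I u} = 0"
      proof (subst prob_Collect_eq_0)
        show "AE w in M. \<not> X w \<le> D.I u" using K by eventually_elim (use n in linarith)
      qed (use X in measurable)
      moreover have "u \<le> measure M {w \<in> space M. X w \<le> D.I u}" using iff[OF u, of "D.I u"] by simp
      ultimately show False using u by simp
    qed
    ultimately show ?thesis by simp
  qed
  have m: "D.I \<in> borel_measurable unit_space"
    using D.measurable_CI by (simp cong: measurable_cong_sets add: sets_unit_space)
  have l: "distr unit_space borel D.I = distr M borel X"
    using D.distr_I_eq_M unfolding unit_space_def .
  show ?thesis
    using D.mono_I m l b iff by (intro exI[of _ D.I]) auto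
qed

lemma integral_law:
  fixes f :: "real \<Rightarrow> real"
  assumes "X \<in> borel_measurable M" "h \<in> borel_measurable unit_space" "distr M borel X = distr unit_space borel h"
    "f \<in> borel_measurable borel"
  shows "(\<integral>w. f (X w) \<partial>M) = (\<integral>u. f (h u) \<partial>unit_space)"
proof -
  have "(\<integral>w. f (X w) \<partial>M) = (\<integral>x. f x \<partial>distr M borel X)"
    using assms by (subst integral_distr) auto
  also have "\<dots> = (\<integral>u. f (h u) \<partial>unit_space)"
    unfolding assms(3) using assms by (subst integral_distr) auto
  finally show ?thesis .
qed

lemma superlinear_icv_mono:
  assumes at: "atomless M" and E: "superlinear_expectation M E"
    and Z: "Z \<in> bounded_rvs M" "Z' \<in> bounded_rvs M"
    and dom: "\<And>t. (\<integral>w. max 0 (t - Z' w) \<partial>M) \<le> (\<integral>w. max 0 (t - Z w) \<partial>M)"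
  shows "E Z \<le> E Z'"
proof -
  obtain U where U: "U \<in> measurable M unit_space" "distr M unit_space U = unit_space"
    using atomless_uniform[OF at] by blast
  obtain K1 K2 where K12: "AE w in M. \<bar>Z w\<bar> \<le> K1" "AE w in M. \<bar>Z' w\<bar> \<le> K2"
    using Z unfolding bounded_rvs_def by blast
  define K where "K = max K1 K2"
  have K: "AE w in M. \<bar>Z w\<bar> \<le> K" using K12(1) by eventually_elim (simp add: K_def)
  have K': "AE w in M. \<bar>Z' w\<bar> \<le> K" using K12(2) by eventually_elim (simp add: K_def)
  have Zm: "Z \<in> borel_measurable M" "Z' \<in> borel_measurable M" using Z by (auto dest: bounded_rvs_measurable)
  obtain q where q: "mono_on {0<..<1} q" "q \<in> borel_measurable unit_space"
    "distr unit_space borel q = distr M borel Z" "\<And>u. 0 < u \<Longrightarrow> u < 1 \<Longrightarrow> \<bar>q u\<bar> \<le> K"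
    using quantile_exists[OF Zm(1) K] by blast
  obtain q' where q': "mono_on {0<..<1} q'" "q' \<in> borel_measurable unit_space"
    "distr unit_space borel q' = distr M borel Z'" "\<And>u. 0 < u \<Longrightarrow> u < 1 \<Longrightarrow> \<bar>q' u\<bar> \<le> K"
    using quantile_exists[OF Zm(2) K'] by blast
  have int: "(\<integral>u. max 0 (t - f u) \<partial>unit_space) = (\<integral>w. max 0 (t - X w) \<partial>M)"
    if "f \<in> borel_measurable unit_space" "X \<in> borel_measurable M" "distr unit_space borel f = distr M borel X" for f X and t :: real
    using integral_law[OF that(2,1) that(3)[symmetric], of "\<lambda>x. max 0 (t - x)"] by simp
  have law: "E X = E (\<lambda>w. f (U w))"
    if "f \<in> borel_measurable unit_space" "\<And>u. 0 < u \<Longrightarrow> u < 1 \<Longrightarrow> \<bar>f u\<bar> \<le> K" "X \<in> bounded_rvs M"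
      "distr unit_space borel f = distr M borel X" for f X
    using that distr_transport[OF U that(1)]
    by (intro superlinear_law[OF E] bounded_rvs_transport[OF U] bounded_rvs_unit) simp_all
  have "E (\<lambda>w. q (U w)) \<le> E (\<lambda>w. q' (U w))"
  proof (rule superlinear_icv_mono_unit[OF superlinear_transport[OF U E] q(1,2,4) q'(1,2,4)])
    fix t show "(\<integral>u. max 0 (t - q' u) \<partial>unit_space) \<le> (\<integral>u. max 0 (t - q u) \<partial>unit_space)"
      unfolding int[OF q(2) Zm(1) q(3)] int[OF q'(2) Zm(2) q'(3)] by (rule dom)
  qed
  then show ?thesis using law[OF q(2,4) Z(1) q(3)] law[OF q'(2,4) Z(2) q'(3)] by simp
qed

end

text \<open>The lattice inequality is informative only for incomparable points, and these are
  opposite corners of a rectangle; for comparable points it is an equality.\<close>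

lemma supermodular_iff:
  "supermodular g \<longleftrightarrow> (\<forall>a a' b b'. a \<le> a' \<longrightarrow> b \<le> b' \<longrightarrow> g (a', b) + g (a, b') \<le> g (a, b) + g (a', b'))"
proof
  assume g: "supermodular g"
  show "\<forall>a a' b b'. a \<le> a' \<longrightarrow> b \<le> b' \<longrightarrow> g (a', b) + g (a, b') \<le> g (a, b) + g (a', b')"
  proof (intro allI impI)
    fix a a' b b' :: real assume ab: "a \<le> a'" "b \<le> b'"
    have "- g (inf (a', b) (a, b')) + - g (sup (a', b) (a, b')) \<le> - g (a', b) + - g (a, b')"
      using g unfolding supermodular_def submodular_def by blast
    moreover have "inf (a', b) (a, b') = (a, b)" "sup (a', b) (a, b') = (a', b')"
      using ab by (simp_all add: inf_prod_def sup_prod_def inf_real_def sup_real_def min_def max_def)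
    ultimately show "g (a', b) + g (a, b') \<le> g (a, b) + g (a', b')" by simp
  qed
next
  assume g: "\<forall>a a' b b'. a \<le> a' \<longrightarrow> b \<le> b' \<longrightarrow> g (a', b) + g (a, b') \<le> g (a, b) + g (a', b')"
  show "supermodular g"
    unfolding supermodular_def submodular_def
  proof (intro allI)
    fix u v :: "real \<times> real"
    obtain a b where u: "u = (a, b)" by (cases u)
    obtain a' b' where v: "v = (a', b')" by (cases v)
    consider "a \<le> a'" "b \<le> b'" | "a' \<le> a" "b' \<le> b" | "a' \<le> a" "b \<le> b'" | "a \<le> a'" "b' \<le> b" by linarith
    then show "- g (inf u v) + - g (sup u v) \<le> - g u + - g v"
    proof cases
      case 3
      have "inf u v = (a', b)" "sup u v = (a, b')"
        using 3 by (simp_all add: u v inf_prod_def sup_prod_def inf_real_def sup_real_def)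
      then show ?thesis using g[rule_format, OF 3] by (simp add: u v)
    next
      case 4
      have "inf u v = (a, b')" "sup u v = (a', b)"
        using 4 by (simp_all add: u v inf_prod_def sup_prod_def inf_real_def sup_real_def)
      then show ?thesis using g[rule_format, OF 4] by (simp add: u v)
    next
      case 1
      then have "inf u v = u" "sup u v = v"
        by (simp_all add: u v inf_prod_def sup_prod_def inf_real_def sup_real_def)
      then show ?thesis by simp
    next
      case 2
      then have "inf u v = v" "sup u v = u"
        by (simp_all add: u v inf_prod_def sup_prod_def inf_real_def sup_real_def)
      then show ?thesis by simp
    qed
  qed
qed

lemmas supermodularD = supermodular_iff[THEN iffD1, rule_format]

text \<open>Monotonicity in a common direction places the values at the mixed corners between those
  at the two diagonal corners. As their sum is also the smaller one, the increasing convex function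
  \<open>\<lambda>x. max 0 (t + x)\<close> preserves the inequality.\<close>

lemma supermodular_positive_part:
  assumes c: "monotone_cost c" "supermodular c"
  shows "supermodular (\<lambda>p. max 0 (t + c p))"
  unfolding supermodular_iff
proof (intro allI impI)
  fix a a' b b' :: real assume ab: "a \<le> a'" "b \<le> b'"
  have s: "c (a', b) + c (a, b') \<le> c (a, b) + c (a', b')" using c(2) ab by (rule supermodularD)
  from c(1)[unfolded monotone_cost_def]
  have "(c (a, b) \<le> c (a', b) \<and> c (a, b) \<le> c (a, b') \<and> c (a', b) \<le> c (a', b') \<and> c (a, b') \<le> c (a', b')) \<or>
    (c (a, b) \<ge> c (a', b) \<and> c (a, b) \<ge> c (a, b') \<and> c (a', b) \<ge> c (a', b') \<and> c (a, b') \<ge> c (a', b'))"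
    using ab by (auto simp: mono_def antimono_def)
  then show "max 0 (t + c (a', b)) + max 0 (t + c (a, b')) \<le> max 0 (t + c (a, b)) + max 0 (t + c (a', b'))"
    using s by (simp add: max_def) linarith
qed

text \<open>Dual potentials of the discrete transport problem; equality holds on the diagonal.\<close>

lemma supermodular_potential:
  fixes G :: "nat \<Rightarrow> nat \<Rightarrow> real"
  assumes G: "\<And>i k l. k \<le> l \<Longrightarrow> G (Suc i) k - G i k \<le> G (Suc i) l - G i l"
  defines "\<phi> \<equiv> \<lambda>j. \<Sum>k<j. G (Suc k) k - G k k"
  shows "G i k \<le> \<phi> i + (G k k - \<phi> k)"
\<comment> \<open>Above the diagonal an increment of \<open>G\<close> in its first index is at most
  the one taken in the larger column \<open>i\<close>, which is the increment of
  \<open>\<phi>\<close>. Below the diagonal both the comparison and the direction are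
  reversed.\<close>
proof (cases "k \<le> i")
  case True
  then show ?thesis
  proof (induction i rule: dec_induct)
    case (step i)
    then show ?case using G[of k i i] by (simp add: \<phi>_def)
  qed simp
next
  case False
  then have "i \<le> k" by simp
  then show ?thesis
  proof (induction i rule: inc_induct)
    case (step i)
    then show ?case using G[of i k i] by (simp add: \<phi>_def)
  qed simp
qed

section \<open>Discretisation of a coupling on a uniform grid\<close>

context unit_partition begin

lemma integral_step: "(\<integral>u. step c u \<partial>unit_space) = (\<Sum>i<m. c i * len i)"
proof -
  have "(\<integral>u. step c u \<partial>unit_space) = (\<Sum>i<m. \<integral>u. c i * indicator {s i..<s (Suc i)} u \<partial>unit_space)"
    unfolding step_def
    by (intro Bochner_Integration.integral_sum integrable_unit_indicator[of "\<lambda>_. c i" "\<bar>c i\<bar>" for i]) auto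
  also have "\<dots> = (\<Sum>i<m. c i * len i)"
    unfolding len_def
    using s_Suc by (intro sum.cong integral_unit_indicator s_nonneg s_le_1 refl) (auto intro: less_imp_le)
  finally show ?thesis .
qed

lemma integrable_step: "integrable unit_space (step c)"
  by (rule integrable_unit[of _ "\<Sum>i<m. \<bar>c i\<bar>"]) (auto simp: step_bounded intro: measurable_unit_space)

end

text \<open>The right end value of \<open>h\<close> on cell \<open>i\<close> of \<open>n\<close>
  equal cells. The last cell ends at 1, where \<open>h\<close> is not controlled, and takes the
  upper bound \<open>K\<close> instead.\<close>

definition grid :: "(real \<Rightarrow> real) \<Rightarrow> real \<Rightarrow> nat \<Rightarrow> nat \<Rightarrow> real" where
  "grid h K n i = (if Suc i < n then h (real (Suc i) / n) else K)"

text \<open>The first grid value that is not below \<open>x\<close>. The second disjunct makes the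
  minimum exist even if \<open>x\<close> exceeds \<open>K\<close>.\<close>

definition grid_index :: "(real \<Rightarrow> real) \<Rightarrow> real \<Rightarrow> nat \<Rightarrow> real \<Rightarrow> nat" where
  "grid_index h K n x = (LEAST i. x \<le> grid h K n i \<or> n - 1 \<le> i)"

lemma grid_index_le: "x \<le> grid h K n i \<or> n - 1 \<le> i \<Longrightarrow> grid_index h K n x \<le> i"
  unfolding grid_index_def by (rule Least_le)

lemma grid_index_prop: "x \<le> grid h K n (grid_index h K n x) \<or> n - 1 \<le> grid_index h K n x"
  unfolding grid_index_def by (rule LeastI[of _ "n - 1"]) simp

lemma le_grid_index: "x \<le> K \<Longrightarrow> x \<le> grid h K n (grid_index h K n x)"
  using grid_index_prop[of x h K n] by (auto simp: grid_def)

lemma grid_index_mono: "x \<le> y \<Longrightarrow> grid_index h K n x \<le> grid_index h K n y"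
  using grid_index_prop[of y h K n] by (intro grid_index_le) auto

lemma grid_mono:
  assumes h: "mono_on {0<..<1} h" "\<And>u. 0 < u \<Longrightarrow> u < 1 \<Longrightarrow> h u \<le> K" and "i \<le> j"
  shows "grid h K n i \<le> grid h K n j"
proof (cases "Suc j < n")
  case True
  then show ?thesis
    using assms(3) by (auto simp: grid_def intro!: mono_onD[OF h(1)] divide_right_mono)
next
  case False
  then show ?thesis by (auto simp: grid_def intro!: h(2))
qed

lemma measurable_mono_grid_index:
  fixes f :: "nat \<Rightarrow> real"
  assumes "mono f"
  shows "(\<lambda>x. f (grid_index h K n x)) \<in> borel_measurable borel"
  using assms grid_index_mono by (intro borel_measurable_mono) (auto simp: mono_def)

lemma bounded_mono_grid_index:
  fixes f :: "nat \<Rightarrow> real"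
  assumes "mono f"
  shows "\<bar>f (grid_index h K n x)\<bar> \<le> \<bar>f 0\<bar> + \<bar>f (n - 1)\<bar>"
proof -
  have "f 0 \<le> f (grid_index h K n x)" "f (grid_index h K n x) \<le> f (n - 1)"
    using assms by (auto intro!: monoD[OF assms] grid_index_le)
  then show ?thesis by linarith
qed

context prob_space begin

text \<open>Weak duality on the grid. Rounding both coordinates up increases \<open>g\<close>, and
  the rounded value is bounded by a sum of potentials, whose integrals depend on the marginal laws
  only. Evaluated along \<open>h\<close> and \<open>k\<close>, that sum is at most the diagonal
  value of the cell, which leaves a Riemann sum.\<close>

lemma comonotone_maximal_increasing:
  fixes g :: "real \<times> real \<Rightarrow> real"
  assumes X: "X \<in> borel_measurable M" "Y \<in> borel_measurable M"
    and XK: "AE w in M. X w \<le> K" "AE w in M. Y w \<le> K"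
    and h: "mono_on {0<..<1} h" "h \<in> borel_measurable unit_space" "\<And>u. 0 < u \<Longrightarrow> u < 1 \<Longrightarrow> h u \<le> K"
    and k: "mono_on {0<..<1} k" "k \<in> borel_measurable unit_space" "\<And>u. 0 < u \<Longrightarrow> u < 1 \<Longrightarrow> k u \<le> K"
    and law: "distr M borel X = distr unit_space borel h" "distr M borel Y = distr unit_space borel k"
    and g: "g \<in> borel_measurable borel" "supermodular g" "\<And>p. 0 \<le> g p" "\<And>p. g p \<le> B"
    and gm: "\<And>x x' y y'. x \<le> x' \<Longrightarrow> y \<le> y' \<Longrightarrow> g (x, y) \<le> g (x', y')"
  shows "(\<integral>w. g (X w, Y w) \<partial>M) \<le> (\<integral>u. g (h u, k u) \<partial>unit_space)"
proof -
  have gXY: "integrable M (\<lambda>w. g (X w, Y w))"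
  proof (rule integrable_const_bound[of _ B])
    show "(\<lambda>w. g (X w, Y w)) \<in> borel_measurable M"
      using g(1) borel_measurable_Pair[OF X] by (rule measurable_compose[rotated])
  qed (use g in auto)
  have ghk: "integrable unit_space (\<lambda>u. g (h u, k u))"
  proof (rule integrable_unit[of _ B])
    show "(\<lambda>w. g (h w, k w)) \<in> borel_measurable unit_space"
      using g(1) borel_measurable_Pair[OF h(2) k(2)] by (rule measurable_compose[rotated])
  qed (use g in auto)
  have *: "(\<integral>w. g (X w, Y w) \<partial>M) \<le> (\<integral>u. g (h u, k u) \<partial>unit_space) + B / n" if n: "n > 0" for n :: nat
  proof -
    interpret P: unit_partition "\<lambda>i. real i / n" n
      using n by unfold_locales (auto simp: divide_strict_right_mono)
    define \<xi> where "\<xi> = grid h K n"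
    define \<eta> where "\<eta> = grid k K n"
    define G where "G = (\<lambda>i j. g (\<xi> i, \<eta> j))"
    define \<phi> where "\<phi> = (\<lambda>j. \<Sum>i<j. G (Suc i) i - G i i)"
    define \<psi> where "\<psi> = (\<lambda>j. G j j - \<phi> j)"
    have \<xi>m: "\<xi> i \<le> \<xi> j" and \<eta>m: "\<eta> i \<le> \<eta> j" if "i \<le> j" for i j
      unfolding \<xi>_def \<eta>_def using grid_mono[OF h(1,3) that] grid_mono[OF k(1,3) that] by auto
    have G: "G (Suc i) l - G i l \<le> G (Suc i) l' - G i l'" if "l \<le> l'" for i l l'
      using supermodularD[OF g(2) \<xi>m[of i "Suc i"] \<eta>m[OF that]] by (simp add: G_def)
    have dual: "G i j \<le> \<phi> i + \<psi> j" for i j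
      using supermodular_potential[of G i j, OF G] unfolding \<phi>_def \<psi>_def by simp
    have \<phi>m: "mono \<phi>"
      unfolding mono_iff_le_Suc \<phi>_def by (auto simp: G_def intro!: gm \<xi>m)
    \<comment> \<open>The increment of \<open>\<psi>\<close> at \<open>j\<close> is
      \<open>G (Suc j) (Suc j) - G (Suc j) j\<close>. Monotone potentials give both measurability of
      \<open>a\<close> and \<open>b\<close> and the bound on the diagonal.\<close>
    have \<psi>m: "mono \<psi>"
      unfolding mono_iff_le_Suc \<psi>_def \<phi>_def by (auto simp: G_def intro!: gm \<eta>m)
    define a where "a = (\<lambda>x. \<phi> (grid_index h K n x))"
    define b where "b = (\<lambda>y. \<psi> (grid_index k K n y))"
    have am: "a \<in> borel_measurable borel" and bm: "b \<in> borel_measurable borel"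
      unfolding a_def b_def using \<phi>m \<psi>m by (auto intro: measurable_mono_grid_index)
    have ab: "\<bar>a x\<bar> \<le> \<bar>\<phi> 0\<bar> + \<bar>\<phi> (n - 1)\<bar>" "\<bar>b x\<bar> \<le> \<bar>\<psi> 0\<bar> + \<bar>\<psi> (n - 1)\<bar>" for x
      unfolding a_def b_def by (rule bounded_mono_grid_index[OF \<phi>m] bounded_mono_grid_index[OF \<psi>m])+
    define A where "A = \<bar>\<phi> 0\<bar> + \<bar>\<phi> (n - 1)\<bar> + \<bar>\<psi> 0\<bar> + \<bar>\<psi> (n - 1)\<bar>"
    have A: "\<bar>a x\<bar> \<le> A" "\<bar>b x\<bar> \<le> A" for x using ab[of x] unfolding A_def by linarith+
    have iX: "integrable M (\<lambda>w. a (X w))" "integrable M (\<lambda>w. b (Y w))"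
      using A measurable_compose[OF X(1) am] measurable_compose[OF X(2) bm]
      by (auto intro!: integrable_const_bound[of _ A])
    have ih: "integrable unit_space (\<lambda>u. a (h u))" "integrable unit_space (\<lambda>u. b (k u))"
      using A measurable_compose[OF h(2) am] measurable_compose[OF k(2) bm]
      by (auto intro!: integrable_unit[of _ A])
    have "(\<integral>w. g (X w, Y w) \<partial>M) \<le> (\<integral>w. a (X w) + b (Y w) \<partial>M)"
    proof (rule integral_mono_AE[OF gXY])
      show "integrable M (\<lambda>w. a (X w) + b (Y w))" using iX by simp
      show "AE w in M. g (X w, Y w) \<le> a (X w) + b (Y w)"
        using XK
      proof eventually_elim
        case (elim w)
        have "g (X w, Y w) \<le> G (grid_index h K n (X w)) (grid_index k K n (Y w))"
          unfolding G_def \<xi>_def \<eta>_def using elim by (intro gm le_grid_index)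
        also have "\<dots> \<le> a (X w) + b (Y w)" unfolding a_def b_def by (rule dual)
        finally show ?case .
      qed
    qed
    also have "\<dots> = (\<integral>w. a (X w) \<partial>M) + (\<integral>w. b (Y w) \<partial>M)" using iX by simp
    also have "\<dots> = (\<integral>u. a (h u) \<partial>unit_space) + (\<integral>u. b (k u) \<partial>unit_space)"
      using integral_law[OF X(1) h(2) law(1) am] integral_law[OF X(2) k(2) law(2) bm] by simp
    also have "\<dots> = (\<integral>u. a (h u) + b (k u) \<partial>unit_space)" using ih by simp
    also have "\<dots> \<le> (\<integral>u. P.step (\<lambda>r. G r r) u \<partial>unit_space)"
    proof (rule integral_mono_AE[OF _ P.integrable_step])
      show "integrable unit_space (\<lambda>u. a (h u) + b (k u))" using ih by simp
      show "AE u in unit_space. a (h u) + b (k u) \<le> P.step (\<lambda>r. G r r) u"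
        using AE_unit P.AE_cell
      proof eventually_elim
        case (elim u)
        then obtain r where r: "r < n" "real r / n < u" "u < real (Suc r) / n" by blast
        \<comment> \<open>On cell \<open>r\<close> the index of \<open>h u\<close> and of
          \<open>k u\<close> is at most \<open>r\<close>, and \<open>\<phi> r + \<psi> r\<close>
          equals \<open>G r r\<close>.\<close>
        have l: "f u \<le> grid f K n r \<or> n - 1 \<le> r" if f: "mono_on {0<..<1} f" for f
        proof (cases "Suc r < n")
          case True
          then show ?thesis using r elim by (auto simp: grid_def intro!: mono_onD[OF f])
        qed auto
        have "a (h u) + b (k u) \<le> \<phi> r + \<psi> r"
          unfolding a_def b_def using h(1) k(1)
          by (intro add_mono monoD[OF \<phi>m] monoD[OF \<psi>m] grid_index_le l)
        also have "\<dots> = P.step (\<lambda>r. G r r) u" using r by (subst P.step_eq[of r]) (auto simp: \<psi>_def)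
        finally show ?case .
      qed
    qed
    also have "\<dots> = (\<Sum>r<n. G r r / n)"
      unfolding P.integral_step P.len_def by (intro sum.cong refl) (simp add: add_divide_distrib)
    also have "\<dots> \<le> (\<integral>u. g (h u, k u) \<partial>unit_space) + B / n"
    proof -
      \<comment> \<open>The diagonal values shifted by one cell: the grid values of the preceding
        cell lie below \<open>h u\<close> and \<open>k u\<close>, and 0 serves on the first cell
        because \<open>g\<close> is nonnegative. The shift loses only the last term, at most
        \<open>B / n\<close>.\<close>
      define c where "c = (\<lambda>r. if r = 0 then 0 else G (r - 1) (r - 1))"
      obtain p where p: "n = Suc p" using n gr0_conv_Suc by blast
      have "(\<integral>u. P.step c u \<partial>unit_space) \<le> (\<integral>u. g (h u, k u) \<partial>unit_space)"
      proof (rule integral_mono_AE[OF P.integrable_step ghk])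
        show "AE u in unit_space. P.step c u \<le> g (h u, k u)"
          using AE_unit P.AE_cell
        proof eventually_elim
          case (elim u)
          then obtain r where r: "r < n" "real r / n < u" "u < real (Suc r) / n" by blast
          have st: "P.step c u = c r" using r by (intro P.step_eq) auto
          show ?case
          proof (cases r)
            case 0
            then show ?thesis using st g(3) by (simp add: c_def)
          next
            case (Suc i)
            have "grid f K n i \<le> f u" if f: "mono_on {0<..<1} f" for f
              using r elim Suc by (auto simp: grid_def intro!: mono_onD[OF f])
            then have "G i i \<le> g (h u, k u)"
              unfolding G_def \<xi>_def \<eta>_def using h(1) k(1) by (intro gm)
            then show ?thesis using st Suc by (simp add: c_def)
          qed
        qed
      qed
      moreover have "(\<integral>u. P.step c u \<partial>unit_space) = (\<Sum>r<n. c r / n)"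
        unfolding P.integral_step P.len_def by (intro sum.cong refl) (simp add: add_divide_distrib)
      moreover have "(\<Sum>r<n. G r r / n) = (\<Sum>r<n. c r / n) + G p p / n"
      proof -
        have "(\<Sum>r<Suc p. c r / n) = (\<Sum>r<p. G r r / n)"
          by (subst sum.lessThan_Suc_shift) (simp add: c_def)
        then show ?thesis using p by simp
      qed
      moreover have "G p p / n \<le> B / n" unfolding G_def using g(4) by (intro divide_right_mono) auto
      ultimately show ?thesis by linarith
    qed
    finally show ?thesis .
  qed
  have "(\<lambda>n. (\<integral>u. g (h u, k u) \<partial>unit_space) + B / real (Suc n)) \<longlonglongrightarrow> (\<integral>u. g (h u, k u) \<partial>unit_space) + 0"
    by (intro tendsto_intros LIMSEQ_Suc lim_const_over_n)
  then show ?thesis using *[of "Suc n" for n] by (auto intro!: LIMSEQ_le_const)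
qed

text \<open>Subtracting functions of one variable makes a supermodular function increasing and changes
  both sides by the same amount.\<close>

lemma comonotone_maximal:
  fixes g :: "real \<times> real \<Rightarrow> real"
  assumes X: "X \<in> borel_measurable M" "Y \<in> borel_measurable M"
    and XK: "AE w in M. \<bar>X w\<bar> \<le> K" "AE w in M. \<bar>Y w\<bar> \<le> K"
    and h: "mono_on {0<..<1} h" "h \<in> borel_measurable unit_space" "\<And>u. 0 < u \<Longrightarrow> u < 1 \<Longrightarrow> \<bar>h u\<bar> \<le> K"
    and k: "mono_on {0<..<1} k" "k \<in> borel_measurable unit_space" "\<And>u. 0 < u \<Longrightarrow> u < 1 \<Longrightarrow> \<bar>k u\<bar> \<le> K"
    and law: "distr M borel X = distr unit_space borel h" "distr M borel Y = distr unit_space borel k"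
    and g: "g \<in> borel_measurable borel" "supermodular g"
    and B: "\<And>x y. \<bar>x\<bar> \<le> K \<Longrightarrow> \<bar>y\<bar> \<le> K \<Longrightarrow> \<bar>g (x, y)\<bar> \<le> B"
  shows "(\<integral>w. g (X w, Y w) \<partial>M) \<le> (\<integral>u. g (h u, k u) \<partial>unit_space)"
proof -
  have K: "0 \<le> K" using h(3)[of "1/2"] by simp
  \<comment> \<open>\<open>g\<close> is bounded only on the square. Clamping, which is increasing
    and keeps supermodularity, extends it to a bounded function on the plane and is the identity on
    the values in question.\<close>
  define cl where "cl = (\<lambda>x. max (- K) (min K x))"
  have cl: "\<bar>cl x\<bar> \<le> K" "- K \<le> cl x" for x using K by (auto simp: cl_def)
  have cl_id: "cl x = x" if "\<bar>x\<bar> \<le> K" for x using that by (auto simp: cl_def)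
  have cl_mono: "cl x \<le> cl y" if "x \<le> y" for x y using that by (auto simp: cl_def)
  have clm: "cl \<in> borel_measurable borel" unfolding cl_def by measurable
  define \<alpha> where "\<alpha> = (\<lambda>x. g (cl x, - K))"
  define \<beta> where "\<beta> = (\<lambda>y. g (- K, cl y))"
  \<comment> \<open>The supermodular mass that \<open>g\<close> assigns to the rectangle from
    \<open>(- K, - K)\<close> to the clamped point. It is nonnegative, vanishes on the lower and
    left sides, grows with the rectangle, and is bounded by \<open>4 * B\<close>.\<close>
  define G where "G = (\<lambda>(x, y). g (cl x, cl y) - \<alpha> x - \<beta> y + g (- K, - K))"
  have gb: "\<bar>g (cl x, cl y)\<bar> \<le> B" "\<bar>\<alpha> x\<bar> \<le> B" "\<bar>\<beta> y\<bar> \<le> B" "\<bar>g (- K, - K)\<bar> \<le> B" for x y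
    unfolding \<alpha>_def \<beta>_def using cl K by (auto intro!: B)
  have m2: "(\<lambda>p::real \<times> real. cl (fst p)) \<in> borel_measurable borel" "(\<lambda>p::real \<times> real. cl (snd p)) \<in> borel_measurable borel"
    by (rule measurable_compose[OF _ clm], intro borel_measurable_continuous_onI continuous_intros)+
  have gpair2: "(\<lambda>p. g (u p, v p)) \<in> borel_measurable N"
    if "u \<in> borel_measurable N" "v \<in> borel_measurable N" for u v and N :: "(real \<times> real) measure"
    using g(1) borel_measurable_Pair[OF that] by (rule measurable_compose[rotated])
  have gpair1: "(\<lambda>p. g (u p, v p)) \<in> borel_measurable N"
    if "u \<in> borel_measurable N" "v \<in> borel_measurable N" for u v and N :: "real measure"
    using g(1) borel_measurable_Pair[OF that] by (rule measurable_compose[rotated])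
  have \<alpha>m: "\<alpha> \<in> borel_measurable borel" and \<beta>m: "\<beta> \<in> borel_measurable borel"
    unfolding \<alpha>_def \<beta>_def using clm by (auto intro!: gpair1)
  have Gm: "G \<in> borel_measurable borel"
    unfolding G_def split_beta \<alpha>_def \<beta>_def using m2
    by (intro borel_measurable_add borel_measurable_diff gpair2) auto
  have sm: "g (cl x', cl y) + g (cl x, cl y') \<le> g (cl x, cl y) + g (cl x', cl y')" if "x \<le> x'" "y \<le> y'" for x x' y y'
    using that by (intro supermodularD[OF g(2)] cl_mono)
  have G: "(\<integral>w. G (X w, Y w) \<partial>M) \<le> (\<integral>u. G (h u, k u) \<partial>unit_space)"
  proof (rule comonotone_maximal_increasing[OF X _ _ h(1,2) _ k(1,2) _ law Gm])
    show "AE w in M. X w \<le> K" using XK(1) by eventually_elim simp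
    show "AE w in M. Y w \<le> K" using XK(2) by eventually_elim simp
    fix u :: real assume "0 < u" "u < 1"
    then show "h u \<le> K" "k u \<le> K" using h(3)[of u] k(3)[of u] by auto
  next
    show "supermodular G" unfolding supermodular_iff G_def using sm by (auto simp: algebra_simps)
  next
    fix p :: "real \<times> real" obtain x y where p: "p = (x, y)" by (cases p)
    have "g (cl x, - K) + g (- K, cl y) \<le> g (- K, - K) + g (cl x, cl y)"
      using cl by (intro supermodularD[OF g(2)])
    then show "0 \<le> G p" by (simp add: p G_def \<alpha>_def \<beta>_def)
    show "G p \<le> 4 * B" using gb(1)[of x y] gb(2)[of x] gb(3)[of y] gb(4) by (simp add: p G_def)
  next
    fix x x' y y' :: real assume le: "x \<le> x'" "y \<le> y'"
    have "g (cl x', - K) + g (cl x, cl y) \<le> g (cl x, - K) + g (cl x', cl y)"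
      using cl cl_mono[OF le(1)] by (intro supermodularD[OF g(2)])
    moreover have "g (cl x', cl y) + g (- K, cl y') \<le> g (- K, cl y) + g (cl x', cl y')"
      using cl cl_mono[OF le(2)] by (intro supermodularD[OF g(2)])
    ultimately show "G (x, y) \<le> G (x', y')" by (simp add: G_def \<alpha>_def \<beta>_def)
  qed
  have iX: "integrable M (\<lambda>w. \<alpha> (X w))" "integrable M (\<lambda>w. \<beta> (Y w))"
    using gb measurable_compose[OF X(1) \<alpha>m] measurable_compose[OF X(2) \<beta>m]
    by (auto intro!: integrable_const_bound[of _ B])
  have ih: "integrable unit_space (\<lambda>u. \<alpha> (h u))" "integrable unit_space (\<lambda>u. \<beta> (k u))"
    using gb measurable_compose[OF h(2) \<alpha>m] measurable_compose[OF k(2) \<beta>m]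
    by (auto intro!: integrable_unit[of _ B])
  have gX: "integrable M (\<lambda>w. g (X w, Y w))"
  proof (rule integrable_const_bound[of _ B])
    show "AE w in M. norm (g (X w, Y w)) \<le> B" using XK by eventually_elim (simp add: B)
    show "(\<lambda>w. g (X w, Y w)) \<in> borel_measurable M"
      using g(1) borel_measurable_Pair[OF X] by (rule measurable_compose[rotated])
  qed
  have gh: "integrable unit_space (\<lambda>u. g (h u, k u))"
    using h(3) k(3) by (intro integrable_unit[of _ B] gpair1 h k B) auto
  have "(\<integral>w. G (X w, Y w) \<partial>M) = (\<integral>w. g (X w, Y w) - \<alpha> (X w) - \<beta> (Y w) + g (- K, - K) \<partial>M)"
  proof (rule integral_cong_AE)
    show "AE w in M. G (X w, Y w) = g (X w, Y w) - \<alpha> (X w) - \<beta> (Y w) + g (- K, - K)"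
      using XK by eventually_elim (simp add: G_def cl_id)
    show "(\<lambda>w. G (X w, Y w)) \<in> borel_measurable M"
      using Gm borel_measurable_Pair[OF X] by (rule measurable_compose[rotated])
    show "(\<lambda>w. g (X w, Y w) - \<alpha> (X w) - \<beta> (Y w) + g (- K, - K)) \<in> borel_measurable M"
      using gX iX by auto
  qed
  also have "\<dots> = (\<integral>w. g (X w, Y w) \<partial>M) - (\<integral>w. \<alpha> (X w) \<partial>M) - (\<integral>w. \<beta> (Y w) \<partial>M) + g (- K, - K)"
    using gX iX by (simp add: prob_space)
  finally have 1: "(\<integral>w. G (X w, Y w) \<partial>M) = \<dots>" .
  have "(\<integral>u. G (h u, k u) \<partial>unit_space) = (\<integral>u. g (h u, k u) - \<alpha> (h u) - \<beta> (k u) + g (- K, - K) \<partial>unit_space)"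
    using h(3) k(3) by (intro Bochner_Integration.integral_cong refl) (simp add: G_def cl_id)
  also have "\<dots> = (\<integral>u. g (h u, k u) \<partial>unit_space) - (\<integral>u. \<alpha> (h u) \<partial>unit_space) - (\<integral>u. \<beta> (k u) \<partial>unit_space) + g (- K, - K)"
    using gh ih by (simp add: unit.prob_space[simplified])
  finally have 2: "(\<integral>u. G (h u, k u) \<partial>unit_space) = \<dots>" .
  show ?thesis
    using G unfolding 1 2
    using integral_law[OF X(1) h(2) law(1) \<alpha>m] integral_law[OF X(2) k(2) law(2) \<beta>m] by linarith
qed

end

section \<open>The extremal copulas\<close>

lemma distr_pair_eqI:
  fixes X Y :: "'a \<Rightarrow> real" and h k :: "'b \<Rightarrow> real"
  assumes "prob_space M" "prob_space N"
    and X: "X \<in> borel_measurable M" "Y \<in> borel_measurable M"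
    and h: "h \<in> borel_measurable N" "k \<in> borel_measurable N"
    and eq: "\<And>x y. measure M {w \<in> space M. X w \<le> x \<and> Y w \<le> y} = measure N {u \<in> space N. h u \<le> x \<and> k u \<le> y}"
  shows "distr M borel (\<lambda>w. (X w, Y w)) = distr N borel (\<lambda>u. (h u, k u))"
proof -
  interpret M: prob_space M by fact
  interpret N: prob_space N by fact
  have m: "(\<lambda>w. (X w, Y w)) \<in> borel_measurable M" "(\<lambda>u. (h u, k u)) \<in> borel_measurable N"
    using X h by (auto intro: borel_measurable_Pair)
  interpret D: prob_space "distr M borel (\<lambda>w. (X w, Y w))" using m(1) by (rule M.prob_space_distr)
  define A where "A = (\<lambda>i::nat. {..(real i, real i)})"
  show ?thesis
  proof (rule measure_eqI_generator_eq[where E="range (\<lambda>a. {..a})" and \<Omega>=UNIV and A=A])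
    show "Int_stable (range (\<lambda>a::real \<times> real. {..a}))"
    proof (rule Int_stableI)
      fix a b :: "(real \<times> real) set" assume "a \<in> range (\<lambda>a. {..a})" "b \<in> range (\<lambda>a. {..a})"
      then obtain p q where "a = {..p}" "b = {..q}" by blast
      then have "a \<inter> b = {..inf p q}" by auto
      then show "a \<inter> b \<in> range (\<lambda>a. {..a})" by blast
    qed
    show "sets (distr M borel (\<lambda>w. (X w, Y w))) = sigma_sets UNIV (range (\<lambda>a. {..a}))"
      "sets (distr N borel (\<lambda>u. (h u, k u))) = sigma_sets UNIV (range (\<lambda>a. {..a}))"
      unfolding sets_distr borel_eq_atMost by (rule sets_measure_of, simp)+
    show "(\<Union>i. A i) = UNIV"
    proof (intro set_eqI iffI UNIV_I)
      fix p :: "real \<times> real"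
      obtain x y where p: "p = (x, y)" by (cases p)
      obtain i where "max x y \<le> real i" using real_arch_simple by blast
      then have "p \<in> A i" by (simp add: A_def p)
      then show "p \<in> (\<Union>i. A i)" by blast
    qed
    fix B :: "(real \<times> real) set" assume "B \<in> range (\<lambda>a. {..a})"
    then obtain x y where B: "B = {..(x, y)}" by auto
    have "emeasure (distr M borel (\<lambda>w. (X w, Y w))) B = ennreal (measure M {w \<in> space M. X w \<le> x \<and> Y w \<le> y})"
      unfolding B using m(1)
      by (subst emeasure_distr) (auto simp: M.emeasure_eq_measure intro!: arg_cong[where f="measure M"])
    moreover have "emeasure (distr N borel (\<lambda>u. (h u, k u))) B = ennreal (measure N {u \<in> space N. h u \<le> x \<and> k u \<le> y})"
      unfolding B using m(2)
      by (subst emeasure_distr) (auto simp: N.emeasure_eq_measure intro!: arg_cong[where f="measure N"])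
    ultimately show "emeasure (distr M borel (\<lambda>w. (X w, Y w))) B = emeasure (distr N borel (\<lambda>u. (h u, k u))) B"
      using eq by simp
  qed (auto simp: A_def)
qed

lemma integral_pair_law:
  fixes g :: "real \<times> real \<Rightarrow> real"
  assumes "X \<in> borel_measurable M" "Y \<in> borel_measurable M" "h \<in> borel_measurable N" "k \<in> borel_measurable N"
    and eq: "distr M borel (\<lambda>w. (X w, Y w)) = distr N borel (\<lambda>u. (h u, k u))" and g: "g \<in> borel_measurable borel"
  shows "(\<integral>w. g (X w, Y w) \<partial>M) = (\<integral>u. g (h u, k u) \<partial>N)"
  using integral_distr[OF borel_measurable_Pair[OF assms(1,2)] g]
    integral_distr[OF borel_measurable_Pair[OF assms(3,4)] g] unfolding eq by simp

text \<open>On the square the extreme values are attained at the lower left and upper right corners,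
  whichever the direction of monotonicity.\<close>

lemma monotone_cost_bounds:
  assumes "monotone_cost c"
  shows "\<exists>B. \<forall>x y. \<bar>x\<bar> \<le> K \<longrightarrow> \<bar>y\<bar> \<le> K \<longrightarrow> \<bar>c (x, y)\<bar> \<le> B"
proof (intro exI allI impI)
  fix x y :: real assume "\<bar>x\<bar> \<le> K" "\<bar>y\<bar> \<le> K"
  then have xy: "- K \<le> x" "x \<le> K" "- K \<le> y" "y \<le> K" by auto
  from assms[unfolded monotone_cost_def]
  have "(c (- K, - K) \<le> c (x, - K) \<and> c (x, - K) \<le> c (x, y) \<and> c (x, y) \<le> c (x, K) \<and> c (x, K) \<le> c (K, K)) \<or>
    (c (- K, - K) \<ge> c (x, - K) \<and> c (x, - K) \<ge> c (x, y) \<and> c (x, y) \<ge> c (x, K) \<and> c (x, K) \<ge> c (K, K))"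
    using xy by (auto simp: mono_def antimono_def)
  then show "\<bar>c (x, y)\<bar> \<le> \<bar>c (- K, - K)\<bar> + \<bar>c (K, K)\<bar>" by linarith
qed

lemma bounded_rvs_common_bound:
  assumes "X \<in> bounded_rvs M" "Y \<in> bounded_rvs M"
  shows "\<exists>K. (AE w in M. \<bar>X w\<bar> \<le> K) \<and> (AE w in M. \<bar>Y w\<bar> \<le> K)"
proof -
  obtain K L where K: "AE w in M. \<bar>X w\<bar> \<le> K" and L: "AE w in M. \<bar>Y w\<bar> \<le> L"
    using assms unfolding bounded_rvs_def by blast
  show ?thesis
  proof (intro exI conjI)
    show "AE w in M. \<bar>X w\<bar> \<le> max K L" using K by eventually_elim simp
    show "AE w in M. \<bar>Y w\<bar> \<le> max K L" using L by eventually_elim simp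
  qed
qed

lemma bounded_rvs_cost:
  assumes c: "cost_function c" "monotone_cost c" and XY: "X \<in> bounded_rvs M" "Y \<in> bounded_rvs M"
  shows "(\<lambda>w. c (X w, Y w)) \<in> bounded_rvs M"
proof -
  obtain K where K: "AE w in M. \<bar>X w\<bar> \<le> K" "AE w in M. \<bar>Y w\<bar> \<le> K"
    using bounded_rvs_common_bound[OF XY] by blast
  obtain B where B: "\<forall>x y. \<bar>x\<bar> \<le> K \<longrightarrow> \<bar>y\<bar> \<le> K \<longrightarrow> \<bar>c (x, y)\<bar> \<le> B"
    using monotone_cost_bounds[OF c(2)] by blast
  show ?thesis
  proof (rule bounded_rvsI)
    show "(\<lambda>w. c (X w, Y w)) \<in> borel_measurable M"
      using c(1)[unfolded cost_function_def] borel_measurable_Pair[OF XY[THEN bounded_rvs_measurable]]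
      by (rule measurable_compose[rotated])
    show "AE w in M. \<bar>c (X w, Y w)\<bar> \<le> B" using K by eventually_elim (simp add: B)
  qed
qed

lemma AE_abs_le_law:
  fixes X X' :: "'a \<Rightarrow> real"
  assumes "X \<in> borel_measurable M" "X' \<in> borel_measurable M" "distr M borel X' = distr M borel X"
    "AE w in M. \<bar>X w\<bar> \<le> K"
  shows "AE w in M. \<bar>X' w\<bar> \<le> K"
proof -
  have "AE x in distr M borel X. \<bar>x\<bar> \<le> K" using assms by (subst AE_distr_iff) auto
  then show ?thesis unfolding assms(3)[symmetric] using assms(2) by (subst (asm) AE_distr_iff) auto
qed

text \<open>Reflecting one coordinate exchanges the diagonal and the mixed corners of a rectangle,
  and the minus sign restores the inequality. Minimality of a coupling thereby becomes maximality of
  its reflection.\<close>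

lemma supermodular_reflect:
  assumes "supermodular g"
  shows "supermodular (\<lambda>(x, y). - g (x, - y))"
  unfolding supermodular_iff
proof (intro allI impI)
  fix a a' b b' :: real assume "a \<le> a'" "b \<le> b'"
  then have "g (a', - b') + g (a, - b) \<le> g (a, - b') + g (a', - b)"
    by (intro supermodularD[OF assms]) auto
  then show "(case (a', b) of (x, y) \<Rightarrow> - g (x, - y)) + (case (a, b') of (x, y) \<Rightarrow> - g (x, - y))
      \<le> (case (a, b) of (x, y) \<Rightarrow> - g (x, - y)) + (case (a', b') of (x, y) \<Rightarrow> - g (x, - y))" by simp
qed

lemma unit_space_reflect:
  "(\<lambda>u. 1 - u) \<in> measurable unit_space unit_space"
  by (rule measurable_into_unit_space) (auto intro: measurable_unit_space)

section \<open>Extremality of the comonotone and countermonotone couplings\<close>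

context prob_space begin

lemma C_plus_maximal:
  assumes XY: "X \<in> bounded_rvs M" "Y \<in> bounded_rvs M" "X' \<in> bounded_rvs M" "Y' \<in> bounded_rvs M"
    and cop: "copula_of M C_plus X Y" and law: "eq_law M X' X" "eq_law M Y' Y"
    and c: "cost_function c" "monotone_cost c" "supermodular c"
  shows "(\<integral>w. max 0 (t + c (X' w, Y' w)) \<partial>M) \<le> (\<integral>w. max 0 (t + c (X w, Y w)) \<partial>M)"
proof -
  note m = XY[THEN bounded_rvs_measurable]
  obtain K where K: "AE w in M. \<bar>X w\<bar> \<le> K" "AE w in M. \<bar>Y w\<bar> \<le> K"
    using bounded_rvs_common_bound[OF XY(1,2)] by blast
  have K': "AE w in M. \<bar>X' w\<bar> \<le> K" "AE w in M. \<bar>Y' w\<bar> \<le> K"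
    using AE_abs_le_law[OF m(1,3) law(1)[unfolded eq_law_def] K(1)]
      AE_abs_le_law[OF m(2,4) law(2)[unfolded eq_law_def] K(2)] .
  obtain h where h: "mono_on {0<..<1} h" "h \<in> borel_measurable unit_space"
    "distr unit_space borel h = distr M borel X" "\<And>u. 0 < u \<Longrightarrow> u < 1 \<Longrightarrow> \<bar>h u\<bar> \<le> K"
    "\<And>u x. 0 < u \<Longrightarrow> u < 1 \<Longrightarrow> u \<le> measure M {w \<in> space M. X w \<le> x} \<longleftrightarrow> h u \<le> x"
    using quantile_exists[OF m(1) K(1)] by blast
  obtain k where k: "mono_on {0<..<1} k" "k \<in> borel_measurable unit_space"
    "distr unit_space borel k = distr M borel Y" "\<And>u. 0 < u \<Longrightarrow> u < 1 \<Longrightarrow> \<bar>k u\<bar> \<le> K"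
    "\<And>u x. 0 < u \<Longrightarrow> u < 1 \<Longrightarrow> u \<le> measure M {w \<in> space M. Y w \<le> x} \<longleftrightarrow> k u \<le> x"
    using quantile_exists[OF m(2) K(2)] by blast
  \<comment> \<open>Both quantile functions stay below their thresholds exactly when
    \<open>u \<le> min F G\<close>, an event of probability \<open>C_plus F G\<close>.\<close>
  have joint: "distr M borel (\<lambda>w. (X w, Y w)) = distr unit_space borel (\<lambda>u. (h u, k u))"
  proof (rule distr_pair_eqI[OF prob_space_axioms prob_space_unit_space m(1,2) h(2) k(2)])
    fix x y
    define F where "F = measure M {w \<in> space M. X w \<le> x}"
    define G where "G = measure M {w \<in> space M. Y w \<le> y}"
    have FG: "0 \<le> min F G" "min F G \<le> 1" by (simp_all add: F_def G_def min_le_iff_disj)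
    have e: "{u \<in> space unit_space. h u \<le> x \<and> k u \<le> y} = {u \<in> {0<..<1}. u \<le> min F G}"
      using h(5)[of _ x] k(5)[of _ y] by (auto simp: F_def G_def)
    have "measure unit_space {u \<in> space unit_space. h u \<le> x \<and> k u \<le> y} = min F G"
      unfolding e using FG by (rule cdf_unit_space)
    also have "\<dots> = measure M {w \<in> space M. X w \<le> x \<and> Y w \<le> y}"
      using cop unfolding copula_of_def C_plus_def F_def G_def by simp
    finally show "measure M {w \<in> space M. X w \<le> x \<and> Y w \<le> y} =
      measure unit_space {u \<in> space unit_space. h u \<le> x \<and> k u \<le> y}" by simp
  qed
  obtain B where B: "\<forall>x y. \<bar>x\<bar> \<le> K \<longrightarrow> \<bar>y\<bar> \<le> K \<longrightarrow> \<bar>c (x, y)\<bar> \<le> B"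
    using monotone_cost_bounds[OF c(2)] by blast
  have gm: "(\<lambda>p. max 0 (t + c p)) \<in> borel_measurable borel" using c(1) unfolding cost_function_def by measurable
  have "(\<integral>w. max 0 (t + c (X' w, Y' w)) \<partial>M) \<le> (\<integral>u. max 0 (t + c (h u, k u)) \<partial>unit_space)"
  proof (rule comonotone_maximal[OF m(3,4) K' h(1,2,4) k(1,2,4) _ _ gm supermodular_positive_part[OF c(2,3)], of "\<bar>t\<bar> + B"])
    show "distr M borel X' = distr unit_space borel h" "distr M borel Y' = distr unit_space borel k"
      using law h(3) k(3) by (simp_all add: eq_law_def)
    fix x y :: real assume "\<bar>x\<bar> \<le> K" "\<bar>y\<bar> \<le> K"
    then have "\<bar>c (x, y)\<bar> \<le> B" using B by simp
    then show "\<bar>max 0 (t + c (x, y))\<bar> \<le> \<bar>t\<bar> + B" by (simp add: max_def) linarith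
  qed
  also have "\<dots> = (\<integral>w. max 0 (t + c (X w, Y w)) \<partial>M)"
    using integral_pair_law[OF m(1,2) h(2) k(2) joint gm] by simp
  finally show ?thesis .
qed

lemma C_minus_minimal:
  assumes XY: "X \<in> bounded_rvs M" "Y \<in> bounded_rvs M" "X' \<in> bounded_rvs M" "Y' \<in> bounded_rvs M"
    and cop: "copula_of M C_minus X Y" and law: "eq_law M X' X" "eq_law M Y' Y"
    and c: "cost_function c" "monotone_cost c" "supermodular c"
  shows "(\<integral>w. max 0 (t + c (X w, Y w)) \<partial>M) \<le> (\<integral>w. max 0 (t + c (X' w, Y' w)) \<partial>M)"
proof -
  note m = XY[THEN bounded_rvs_measurable]
  obtain K where K: "AE w in M. \<bar>X w\<bar> \<le> K" "AE w in M. \<bar>Y w\<bar> \<le> K"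
    using bounded_rvs_common_bound[OF XY(1,2)] by blast
  have K': "AE w in M. \<bar>X' w\<bar> \<le> K" "AE w in M. \<bar>Y' w\<bar> \<le> K"
    using AE_abs_le_law[OF m(1,3) law(1)[unfolded eq_law_def] K(1)]
      AE_abs_le_law[OF m(2,4) law(2)[unfolded eq_law_def] K(2)] .
  obtain h where h: "mono_on {0<..<1} h" "h \<in> borel_measurable unit_space"
    "distr unit_space borel h = distr M borel X" "\<And>u. 0 < u \<Longrightarrow> u < 1 \<Longrightarrow> \<bar>h u\<bar> \<le> K"
    "\<And>u x. 0 < u \<Longrightarrow> u < 1 \<Longrightarrow> u \<le> measure M {w \<in> space M. X w \<le> x} \<longleftrightarrow> h u \<le> x"
    using quantile_exists[OF m(1) K(1)] by blast
  obtain q where q: "mono_on {0<..<1} q" "q \<in> borel_measurable unit_space"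
    "distr unit_space borel q = distr M borel Y" "\<And>u. 0 < u \<Longrightarrow> u < 1 \<Longrightarrow> \<bar>q u\<bar> \<le> K"
    "\<And>u x. 0 < u \<Longrightarrow> u < 1 \<Longrightarrow> u \<le> measure M {w \<in> space M. Y w \<le> x} \<longleftrightarrow> q u \<le> x"
    using quantile_exists[OF m(2) K(2)] by blast
  define r where "r = (\<lambda>u. q (1 - u))"
  have rm: "r \<in> borel_measurable unit_space"
    unfolding r_def using unit_space_reflect q(2) by (rule measurable_compose)
  have rK: "\<bar>r u\<bar> \<le> K" if "0 < u" "u < 1" for u unfolding r_def using that by (intro q(4)) auto
  have joint: "distr M borel (\<lambda>w. (X w, Y w)) = distr unit_space borel (\<lambda>u. (h u, r u))"
  proof (rule distr_pair_eqI[OF prob_space_axioms prob_space_unit_space m(1,2) h(2) rm])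
    fix x y
    define F where "F = measure M {w \<in> space M. X w \<le> x}"
    define G where "G = measure M {w \<in> space M. Y w \<le> y}"
    have FG: "0 \<le> F" "F \<le> 1" "0 \<le> G" "G \<le> 1" by (simp_all add: F_def G_def)
    \<comment> \<open>Reading the second quantile function backwards turns the event into the
      interval from \<open>1 - G\<close> to \<open>F\<close>, whose length is
      \<open>C_minus F G\<close>.\<close>
    have hr: "h u \<le> x \<and> r u \<le> y \<longleftrightarrow> 1 - G \<le> u \<and> u \<le> F" if "0 < u" "u < 1" for u
      using h(5)[OF that, of x] q(5)[of "1 - u" y] that by (auto simp: F_def G_def r_def)
    have ne: "AE u in unit_space. u \<notin> {F, 1 - G}" by (rule AE_unit_space_countable) simp
    have "measure unit_space {u \<in> space unit_space. h u \<le> x \<and> r u \<le> y} = measure unit_space {1 - G<..<F}"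
    proof (rule measure_eq_AE)
      show "AE u in unit_space. u \<in> {u \<in> space unit_space. h u \<le> x \<and> r u \<le> y} \<longleftrightarrow> u \<in> {1 - G<..<F}"
        using AE_unit ne by eventually_elim (use hr in auto)
      show "{u \<in> space unit_space. h u \<le> x \<and> r u \<le> y} \<in> sets unit_space" using h(2) rm by measurable
      show "{1 - G<..<F} \<in> sets unit_space"
        using FG by (auto simp: sets_unit_space sets_restrict_space_iff)
    qed
    also have "\<dots> = max (F + G - 1) 0"
    proof (cases "1 - G \<le> F")
      case True
      then show ?thesis using FG by (subst measure_unit_space) auto
    qed simp
    also have "\<dots> = measure M {w \<in> space M. X w \<le> x \<and> Y w \<le> y}"
      using cop unfolding copula_of_def C_minus_def F_def G_def by simp
    finally show "measure M {w \<in> space M. X w \<le> x \<and> Y w \<le> y} =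
      measure unit_space {u \<in> space unit_space. h u \<le> x \<and> r u \<le> y}" by simp
  qed
  \<comment> \<open>\<open>r\<close> decreases, so \<open>h\<close> and \<open>k\<close> are
    comonotone. The maximality theorem is applied to them and to \<open>X'\<close> and
    \<open>- Y'\<close>.\<close>
  define k where "k = (\<lambda>u. - r u)"
  have km: "k \<in> borel_measurable unit_space" unfolding k_def using rm by measurable
  have kmono: "mono_on {0<..<1} k"
    unfolding k_def r_def by (rule mono_onI) (auto intro!: mono_onD[OF q(1)])
  have sm: "snd \<in> measurable borel (borel :: real measure)"
    by (intro borel_measurable_continuous_onI continuous_intros)
  \<comment> \<open>The law of \<open>r\<close> is read off as the second marginal of the joint law
    just found, rather than from a reflection of the unit interval.\<close>
  have "distr M borel Y = distr (distr M borel (\<lambda>w. (X w, Y w))) borel snd"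
    using sm borel_measurable_Pair[OF m(1,2)] by (subst distr_distr) (auto simp: comp_def)
  also have "\<dots> = distr unit_space borel r"
    unfolding joint using sm borel_measurable_Pair[OF h(2) rm] by (subst distr_distr) (auto simp: comp_def)
  finally have "distr (distr M borel Y) borel uminus = distr (distr unit_space borel r) borel uminus" by simp
  moreover have "distr (distr M borel Y') borel uminus = distr M borel (\<lambda>w. - Y' w)"
    using m(4) by (subst distr_distr) (auto simp: comp_def)
  moreover have "distr (distr unit_space borel r) borel uminus = distr unit_space borel k"
    using rm by (subst distr_distr) (auto simp: comp_def k_def)
  ultimately have lawk: "distr M borel (\<lambda>w. - Y' w) = distr unit_space borel k"
    using law(2) by (simp add: eq_law_def)
  obtain B where B: "\<forall>x y. \<bar>x\<bar> \<le> K \<longrightarrow> \<bar>y\<bar> \<le> K \<longrightarrow> \<bar>c (x, y)\<bar> \<le> B"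
    using monotone_cost_bounds[OF c(2)] by blast
  have gm: "(\<lambda>p. max 0 (t + c p)) \<in> borel_measurable borel" using c(1) unfolding cost_function_def by measurable
  define g where "g = (\<lambda>(x, y). - max 0 (t + c (x, - y)))"
  have g: "supermodular g"
    unfolding g_def by (rule supermodular_reflect[OF supermodular_positive_part[OF c(2,3)]])
  have "(\<lambda>p::real \<times> real. (fst p, - snd p)) \<in> borel_measurable borel"
    by (intro borel_measurable_continuous_onI continuous_intros)
  then have gm': "g \<in> borel_measurable borel"
    using measurable_compose[OF _ gm] unfolding g_def split_beta by (intro borel_measurable_uminus) auto
  have "(\<integral>w. g (X' w, - Y' w) \<partial>M) \<le> (\<integral>u. g (h u, k u) \<partial>unit_space)"
  proof (rule comonotone_maximal[OF m(3) _ K'(1) _ h(1,2,4) kmono km _ _ lawk gm' g, of "\<bar>t\<bar> + B"])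
    show "(\<lambda>w. - Y' w) \<in> borel_measurable M" using m(4) by measurable
    show "AE w in M. \<bar>- Y' w\<bar> \<le> K" using K'(2) by simp
    show "\<bar>k u\<bar> \<le> K" if "0 < u" "u < 1" for u using rK[OF that] by (simp add: k_def)
    show "distr M borel X' = distr unit_space borel h" using law(1) h(3) by (simp add: eq_law_def)
    fix x y :: real assume "\<bar>x\<bar> \<le> K" "\<bar>y\<bar> \<le> K"
    then have "\<bar>c (x, - y)\<bar> \<le> B" using B by simp
    then show "\<bar>g (x, y)\<bar> \<le> \<bar>t\<bar> + B" by (simp add: g_def max_def) linarith
  qed
  then have "(\<integral>u. max 0 (t + c (h u, r u)) \<partial>unit_space) \<le> (\<integral>w. max 0 (t + c (X' w, Y' w)) \<partial>M)"
    by (simp add: g_def k_def)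
  then show ?thesis
    using integral_pair_law[OF m(1,2) h(2) rm joint gm] by simp
qed

end

text \<open>Realises a copula as the joint law of two functions of one uniform variable: the
  identity twice for \<open>C_plus\<close>, the identity and its reflection for
  \<open>C_minus\<close>.\<close>

lemma copula_distrI:
  assumes fg: "f \<in> borel_measurable borel" "g \<in> borel_measurable borel"
    and "distr (uniform_measure lborel {0..1::real}) borel f = uniform_measure lborel {0..1}"
    and "distr (uniform_measure lborel {0..1::real}) borel g = uniform_measure lborel {0..1}"
    and C: "\<And>u v. u \<in> {0..1} \<Longrightarrow> v \<in> {0..1} \<Longrightarrow> C u v = measure lborel {w \<in> {0..1}. f w \<le> u \<and> g w \<le> v}"
  shows "copula C"
proof -
  let ?U = "uniform_measure lborel {0..1::real}"
  interpret U: prob_space ?U by (rule prob_space_uniform_measure) auto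
  define \<mu> where "\<mu> = distr ?U borel (\<lambda>w. (f w, g w))"
  have p: "(\<lambda>w. (f w, g w)) \<in> borel_measurable ?U" using borel_measurable_Pair[OF fg] by simp
  have sm: "fst \<in> measurable borel (borel :: real measure)" "snd \<in> measurable borel (borel :: real measure)"
    by (intro borel_measurable_continuous_onI continuous_intros)+
  have "prob_space \<mu>" unfolding \<mu>_def using p by (rule U.prob_space_distr)
  moreover have "distr \<mu> borel fst = uniform_measure lborel {0..1}"
    unfolding \<mu>_def using p sm assms(3) by (subst distr_distr) (auto simp: comp_def)
  moreover have "distr \<mu> borel snd = uniform_measure lborel {0..1}"
    unfolding \<mu>_def using p sm assms(4) by (subst distr_distr) (auto simp: comp_def)
  moreover have "C u v = measure \<mu> ({..u} \<times> {..v})" if "u \<in> {0..1}" "v \<in> {0..1}" for u v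
  proof -
    have "{..u} \<times> {..v} = {..(u, v)}" by auto
    then have s: "{..u} \<times> {..v} \<in> sets borel" by simp
    have "measure \<mu> ({..u} \<times> {..v}) = measure ?U ((\<lambda>w. (f w, g w)) -` ({..u} \<times> {..v}))"
      unfolding \<mu>_def using p s by (subst measure_distr) auto
    also have "\<dots> = measure lborel ({0..1} \<inter> (\<lambda>w. (f w, g w)) -` ({..u} \<times> {..v}))"
    proof -
      have "(\<lambda>w. (f w, g w)) -` ({..u} \<times> {..v}) \<in> sets borel"
        using measurable_sets[OF borel_measurable_Pair[OF fg] s] by simp
      then show ?thesis by (subst measure_uniform_measure) auto
    qed
    also have "{0..1} \<inter> (\<lambda>w. (f w, g w)) -` ({..u} \<times> {..v}) = {w \<in> {0..1}. f w \<le> u \<and> g w \<le> v}" by auto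
    finally show ?thesis using C[OF that] by simp
  qed
  ultimately show ?thesis unfolding copula_def by (intro exI[of _ \<mu>]) (auto simp: \<mu>_def)
qed

lemma copula_C_plus: "copula C_plus"
proof (rule copula_distrI[of "\<lambda>w. w" "\<lambda>w. w"])
  show "distr (uniform_measure lborel {0..1::real}) borel (\<lambda>w. w) = uniform_measure lborel {0..1}"
    by (rule distr_id2) simp
  then show "distr (uniform_measure lborel {0..1::real}) borel (\<lambda>w. w) = uniform_measure lborel {0..1}" .
  fix u v :: real assume uv: "u \<in> {0..1}" "v \<in> {0..1}"
  have "{w \<in> {0..1}. w \<le> u \<and> w \<le> v} = {0..min u v}" using uv by auto
  then show "C_plus u v = measure lborel {w \<in> {0..1}. w \<le> u \<and> w \<le> v}" using uv by (simp add: C_plus_def)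
qed auto

lemma distr_uniform_reflect:
  "distr (uniform_measure lborel {0..1::real}) borel (\<lambda>w. 1 - w) = uniform_measure lborel {0..1}"
proof (rule measure_eqI)
  fix A assume "A \<in> sets (distr (uniform_measure lborel {0..1::real}) borel (\<lambda>w. 1 - w))"
  then have A: "A \<in> sets borel" by simp
  have lb: "lborel = distr lborel borel (\<lambda>w. 1 - w :: real)"
    using lborel_real_affine[of "- 1" 1] by (simp add: density_1)
  have m: "(\<lambda>w. 1 - w) -` A \<in> sets borel"
    using A measurable_sets[of "\<lambda>w. 1 - w :: real" borel borel A] by simp
  have "emeasure (distr (uniform_measure lborel {0..1::real}) borel (\<lambda>w. 1 - w)) A =
      emeasure lborel ({0..1} \<inter> (\<lambda>w. 1 - w) -` A)"
    using A m by (subst emeasure_distr) (auto simp: divide_ennreal_def)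
  also have "{0..1} \<inter> (\<lambda>w. 1 - w) -` A = (\<lambda>w. 1 - w) -` ({0..1} \<inter> A)" by auto
  also have "emeasure lborel \<dots> = emeasure (distr lborel borel (\<lambda>w. 1 - w :: real)) ({0..1} \<inter> A)"
    using A by (subst emeasure_distr) auto
  also have "\<dots> = emeasure (uniform_measure lborel {0..1}) A"
    unfolding lb[symmetric] using A by (simp add: divide_ennreal_def)
  finally show "emeasure (distr (uniform_measure lborel {0..1::real}) borel (\<lambda>w. 1 - w)) A =
      emeasure (uniform_measure lborel {0..1}) A" .
qed simp

lemma copula_C_minus: "copula C_minus"
proof (rule copula_distrI[OF _ _ _ distr_uniform_reflect])
  show "distr (uniform_measure lborel {0..1::real}) borel (\<lambda>w. w) = uniform_measure lborel {0..1}"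
    by (rule distr_id2) simp
  fix u v :: real assume uv: "u \<in> {0..1}" "v \<in> {0..1}"
  have "{w \<in> {0..1}. w \<le> u \<and> 1 - w \<le> v} = {1 - v..u}" using uv by auto
  then show "C_minus u v = measure lborel {w \<in> {0..1}. w \<le> u \<and> 1 - w \<le> v}" using uv by (simp add: C_minus_def)
qed auto

section \<open>Conjugate expectations and the theorem\<close>

lemma superlinear_of_sublinear:
  assumes E: "sublinear_expectation M E"
  shows "superlinear_expectation M (\<lambda>X. - E (\<lambda>w. - X w))"
proof -
  have n: "(\<lambda>w. - X w) \<in> bounded_rvs M" if "X \<in> bounded_rvs M" for X
    using bounded_rvs_scale[OF that, of "- 1"] by simp
  have N: "nonlinear_expectation M E"
    and add: "\<And>X Y. X \<in> bounded_rvs M \<Longrightarrow> Y \<in> bounded_rvs M \<Longrightarrow> E (\<lambda>w. X w + Y w) \<le> E X + E Y"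
    and scale: "\<And>X r. X \<in> bounded_rvs M \<Longrightarrow> 0 \<le> r \<Longrightarrow> E (\<lambda>w. r * X w) = r * E X"
    using E unfolding sublinear_expectation_def by blast+
  have mono: "\<And>X Y. X \<in> bounded_rvs M \<Longrightarrow> Y \<in> bounded_rvs M \<Longrightarrow> AE w in M. X w \<le> Y w \<Longrightarrow> E X \<le> E Y"
    and const: "\<And>a. E (\<lambda>_. a) = a"
    and law: "\<And>X Y. X \<in> bounded_rvs M \<Longrightarrow> Y \<in> bounded_rvs M \<Longrightarrow> eq_law M X Y \<Longrightarrow> E X = E Y"
    using N unfolding nonlinear_expectation_def by blast+
  have law': "eq_law M (\<lambda>w. - X w) (\<lambda>w. - Y w)"
    if "X \<in> bounded_rvs M" "Y \<in> bounded_rvs M" "eq_law M X Y" for X Y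
  proof -
    have "distr M borel (\<lambda>w. - Z w) = distr (distr M borel Z) borel uminus" if "Z \<in> bounded_rvs M" for Z
      using bounded_rvs_measurable[OF that] by (subst distr_distr) (auto simp: comp_def)
    then show ?thesis using that by (simp add: eq_law_def)
  qed
  show ?thesis
    unfolding superlinear_expectation_def nonlinear_expectation_def
  proof (intro conjI ballI allI impI)
    fix X Y assume XY: "X \<in> bounded_rvs M" "Y \<in> bounded_rvs M"
    show "- E (\<lambda>w. - X w) \<le> - E (\<lambda>w. - Y w)" if "AE w in M. X w \<le> Y w"
      using mono[OF n[OF XY(2)] n[OF XY(1)]] that by simp
    show "- E (\<lambda>w. - X w) = - E (\<lambda>w. - Y w)" if "eq_law M X Y"
      using law[OF n[OF XY(1)] n[OF XY(2)] law'[OF XY that]] by simp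
    show "- E (\<lambda>w. - X w) + - E (\<lambda>w. - Y w) \<le> - E (\<lambda>w. - (X w + Y w))"
      using add[OF n[OF XY(1)] n[OF XY(2)]] by simp
  next
    fix X and r :: real assume "X \<in> bounded_rvs M" "0 \<le> r"
    then show "- E (\<lambda>w. - (r * X w)) = r * - E (\<lambda>w. - X w)" using scale[OF n, of X r] by simp
  qed (simp add: const)
qed

lemma monotone_cost_uminus: "monotone_cost c \<Longrightarrow> monotone_cost (\<lambda>p. - c p)"
  unfolding monotone_cost_def mono_def antimono_def by auto

theorem theorem1:
  fixes M :: "'a measure"
  assumes "prob_space M" and "atomless M"
  shows "(\<forall>E c. superlinear_expectation M E \<and> cost_function c \<and> monotone_cost c \<and> submodular c
            \<longrightarrow> universally_optimal M c E C_plus) \<and>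
         (\<forall>E c. sublinear_expectation M E \<and> cost_function c \<and> monotone_cost c \<and> supermodular c
            \<longrightarrow> universally_optimal M c E C_minus)"
proof (intro conjI allI impI)
  interpret prob_space M by fact
  fix E c assume "superlinear_expectation M E \<and> cost_function c \<and> monotone_cost c \<and> submodular c"
  then have E: "superlinear_expectation M E" and c: "cost_function c" "monotone_cost c" "submodular c" by auto
  have c': "cost_function (\<lambda>p. - c p)" "monotone_cost (\<lambda>p. - c p)" "supermodular (\<lambda>p. - c p)"
    using c monotone_cost_uminus by (auto simp: cost_function_def supermodular_def)
  show "universally_optimal M c E C_plus"
    unfolding universally_optimal_def
  proof (intro conjI ballI impI copula_C_plus)
    fix X Y X' Y'
    assume XY: "X \<in> bounded_rvs M" "Y \<in> bounded_rvs M" and cop: "copula_of M C_plus X Y"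
      and XY': "X' \<in> bounded_rvs M" "Y' \<in> bounded_rvs M" and law: "eq_law M X' X" "eq_law M Y' Y"
    show "E (\<lambda>w. c (X w, Y w)) \<le> E (\<lambda>w. c (X' w, Y' w))"
    proof (rule superlinear_icv_mono[OF assms(2) E bounded_rvs_cost[OF c(1,2) XY] bounded_rvs_cost[OF c(1,2) XY']])
      fix t
      \<comment> \<open>Since \<open>- c\<close> is supermodular, the comonotone pair has the
        largest integrals of (t - c)^+; its cost is therefore the smaller one in the increasing
        concave order.\<close>
      show "(\<integral>w. max 0 (t - c (X' w, Y' w)) \<partial>M) \<le> (\<integral>w. max 0 (t - c (X w, Y w)) \<partial>M)"
        using C_plus_maximal[OF XY XY' cop law c', of t] by simp
    qed
  qed
next
  interpret prob_space M by fact
  fix E c assume "sublinear_expectation M E \<and> cost_function c \<and> monotone_cost c \<and> supermodular c"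
  then have E: "sublinear_expectation M E" and c: "cost_function c" "monotone_cost c" "supermodular c" by auto
  have c': "cost_function (\<lambda>p. - c p)" "monotone_cost (\<lambda>p. - c p)"
    using c monotone_cost_uminus by (auto simp: cost_function_def)
  show "universally_optimal M c E C_minus"
    unfolding universally_optimal_def
  proof (intro conjI ballI impI copula_C_minus)
    fix X Y X' Y'
    assume XY: "X \<in> bounded_rvs M" "Y \<in> bounded_rvs M" and cop: "copula_of M C_minus X Y"
      and XY': "X' \<in> bounded_rvs M" "Y' \<in> bounded_rvs M" and law: "eq_law M X' X" "eq_law M Y' Y"
    \<comment> \<open>The conjugate expectation is evaluated at \<open>- c\<close>. Here the pair
      with copula \<open>C_minus\<close> has the smallest integrals of (t + c)^+, so its negated
      cost is the larger one in the order.\<close>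
    have "- E (\<lambda>w. - (- c (X' w, Y' w))) \<le> - E (\<lambda>w. - (- c (X w, Y w)))"
    proof (rule superlinear_icv_mono[OF assms(2) superlinear_of_sublinear[OF E]
          bounded_rvs_cost[OF c' XY'] bounded_rvs_cost[OF c' XY]])
      fix t
      show "(\<integral>w. max 0 (t - (- c (X w, Y w))) \<partial>M) \<le> (\<integral>w. max 0 (t - (- c (X' w, Y' w))) \<partial>M)"
        using C_minus_minimal[OF XY XY' cop law c, of t] by simp
    qed
    then show "E (\<lambda>w. c (X w, Y w)) \<le> E (\<lambda>w. c (X' w, Y' w))" by simp
  qed
qed

end
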